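(* Let $0<\alpha\le 1$, $\beta>0$, $\lambda>0$, $l>0$, and let $p\in C^1([0,l])$, $q\in C([0,l])$ with $p(x)>0$ and $q(x)\ge 0$ for all $x\in[0,l]$. Let $X_k$ be an eigenfunction corresponding to an eigenvalue $\lambda_k$ ($k\in\{1,2,\dots\}$) of the eigenvalue problem $L(X)=\lambda X$ on $(0,l)$, $X(0)=X(l)=0$. Consider the one-dimensional time-fractional diffusion equation $$(D_t^{\alpha}u)(x,t)=\frac{\partial}{\partial x}\left(p(x)\frac{\partial u}{\partial x}\right)-q(x)\,u+F(x,t),\quad x\in(0,l),\ t>0,$$ with the homogeneous initial condition $u(x,0)=0$, $0\le x\le l$, the homogeneous boundary conditions $u(0,t)=u(l,t)=0$, $t\ge 0$, and the source function $$F(x,t)=\psi(t)\,X_k(x),\qquad \psi(t)=t^{\beta-1}E_{\alpha,\beta}(-\lambda t^{\alpha}).$$ Then the solution of this problem (in the sense of the Fourier series formula given in the context) is given by $$u(x,t)=\frac{\lambda E_{\alpha,\alpha+\beta}(-\lambda t^\alpha)-\lambda_kE_{\alpha,\alpha+\beta}(-\lambda_kt^\alpha)}{\lambda-\lambda_k}\,t^{\alpha+\beta-1}X_k(x)$$ in the case $\lambda\neq\lambda_k$, and by $$u(x,t)=\frac{1}{\alpha}\left(E_{\alpha,\alpha+\beta-1}(-\lambda_kt^\alpha)+(1-\beta)E_{\alpha,\alpha+\beta}(-\lambda_kt^\alpha)\right)t^{\alpha+\beta-1}X_k(x)$$ in the case $\lambda=\lambda_k$. Moreover, writing $u(x,t)=\phi(t)X_k(x)$,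 the asymptotics of the solution as $t\to+\infty$ is the same in both cases: $$\phi(t)=\begin{cases}O(t^{\beta-\alpha-1}),\ t\to+\infty, & \text{if }\alpha\neq\beta,\\ O(t^{-\alpha-1}),\ t\to+\infty, & \text{if }\alpha=\beta.\end{cases}$$
   Context: The operator $L$ is $L(f):=-\frac{d}{dx}\left(p(x)\frac{df}{dx}\right)+q(x)f$ on $(0,l)$. The eigenvalue problem $L(X)=\lambda X$, $X(0)=X(l)=0$ has countably many eigenvalues $0<\lambda_1\le\lambda_2\le\dots$ (listed with multiplicity), with corresponding eigenfunctions $X_i\in C^1([0,l])\cap C^2((0,l))$, $L(X_i)=\lambda_iX_i$, forming a complete orthonormal system in $L^2(0,l)$. The symbol $(f,g)$ denotes the standard scalar product in $L^2(0,l)$. The generalized Mittag-Leffler function is $E_{\alpha,\beta}(z):=\sum_{k=0}^\infty\frac{z^k}{\Gamma(\alpha k+\beta)}$ (with $1/\Gamma$ taken to be $0$ at the poles of $\Gamma$), and $E_\alpha:=E_{\alpha,1}$. The Caputo fractional derivative of order $\alpha$, $0<\alpha\le 1$, is $(D^\alpha f)(t):=(I^{1-\alpha}f')(t)$, where $(I^{\gamma}f)(t):=\frac{1}{\Gamma(\gamma)}\int_0^t(t-\tau)^{\gamma-1}f(\tau)\,d\tau$ for $0<\gamma<1$ and $I^0f:=f$. The symbol $D_t^\alpha$ denotes this derivative applied in the variable $t$ for fixed $x$. The solution of the initial-boundary-value problem for the inhomogeneous equation with initial condition $u(x,0)=u_0(x)$ and homogeneous Dirichlet boundary conditions is understood here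 as the one given by the Fourier series $$u(x,t)=\sum_{i=1}^\infty\left(c_i\,E_\alpha(-\lambda_it^\alpha)+\int_0^t\tau^{\alpha-1}E_{\alpha,\alpha}(-\lambda_i\tau^\alpha)F_i(t-\tau)\,d\tau\right)X_i(x),$$ with $c_i=(u_0,X_i)$ and $F_i(t)=(F(\cdot,t),X_i)$. *)

theory Defs
  imports "HOL-Analysis.Analysis" "HOL-Library.Landau_Symbols"
begin

text \<open>Since \<^const>\<open>rGamma\<close> is the entire function \<open>1 / \<Gamma>\<close>, it vanishes at the poles of \<open>\<Gamma>\<close>.\<close>

definition mittag_leffler :: "real \<Rightarrow> real \<Rightarrow> real \<Rightarrow> real" where
  "mittag_leffler \<alpha> \<beta> z = (\<Sum>k. z ^ k * rGamma (\<alpha> * real k + \<beta>))"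

text \<open>Derivatives are relative to the set, hence one-sided at the endpoints of a closed interval.\<close>

definition C1_on :: "real set \<Rightarrow> (real \<Rightarrow> real) \<Rightarrow> bool" where
  "C1_on S f \<longleftrightarrow>
     (\<exists>f'. (\<forall>x\<in>S. (f has_real_derivative f' x) (at x within S)) \<and> continuous_on S f')"

definition C2_on :: "real set \<Rightarrow> (real \<Rightarrow> real) \<Rightarrow> bool" where
  "C2_on S f \<longleftrightarrow>
     (\<exists>f'. (\<forall>x\<in>S. (f has_real_derivative f' x) (at x within S)) \<and> C1_on S f')"

definition L2 :: "real \<Rightarrow> (real \<Rightarrow> real) \<Rightarrow> bool" where
  "L2 l f \<longleftrightarrow> f \<in> borel_measurable (lebesgue_on {0<..<l}) \<and>
     integrable (lebesgue_on {0<..<l}) (\<lambda>x. (f x)\<^sup>2)"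

definition inner_L2 :: "real \<Rightarrow> (real \<Rightarrow> real) \<Rightarrow> (real \<Rightarrow> real) \<Rightarrow> real" where
  "inner_L2 l f g = (LINT x|lebesgue_on {0<..<l}. f x * g x)"

definition complete_orthonormal :: "real \<Rightarrow> (nat \<Rightarrow> real \<Rightarrow> real) \<Rightarrow> bool" where
  "complete_orthonormal l X \<longleftrightarrow>
     (\<forall>i. L2 l (X i)) \<and>
     (\<forall>i j. inner_L2 l (X i) (X j) = (if i = j then 1 else 0)) \<and>
     (\<forall>f. L2 l f \<longrightarrow>
        (\<lambda>n. LINT x|lebesgue_on {0<..<l}. (f x - (\<Sum>i<n. inner_L2 l f (X i) * X i x))\<^sup>2)
          \<longlonglongrightarrow> 0)"

definition SL_op ::
    "(real \<Rightarrow> real) \<Rightarrow> (real \<Rightarrow> real) \<Rightarrow> (real \<Rightarrow> real) \<Rightarrow> real \<Rightarrow> real" where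
  "SL_op p q f x = - deriv (\<lambda>y. p y * deriv f y) x + q x * f x"

definition SL_eigenfunction ::
    "(real \<Rightarrow> real) \<Rightarrow> (real \<Rightarrow> real) \<Rightarrow> real \<Rightarrow> real \<Rightarrow> (real \<Rightarrow> real) \<Rightarrow> bool" where
  "SL_eigenfunction p q l \<mu> Y \<longleftrightarrow>
     C1_on {0..l} Y \<and> C2_on {0<..<l} Y \<and>
     (\<forall>x\<in>{0<..<l}. SL_op p q Y x = \<mu> * Y x) \<and>
     Y 0 = 0 \<and> Y l = 0 \<and> (\<exists>x\<in>{0..l}. Y x \<noteq> 0)"

text \<open>Indices start at 0, so \<open>\<Lambda> i\<close> and \<open>X i\<close> are the eigenvalue and eigenfunction usually
  numbered \<open>i + 1\<close>. Completeness forces every eigenvalue to occur, as often as its multiplicity.\<close>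

definition SL_eigensystem ::
    "(real \<Rightarrow> real) \<Rightarrow> (real \<Rightarrow> real) \<Rightarrow> real \<Rightarrow> (nat \<Rightarrow> real) \<Rightarrow> (nat \<Rightarrow> real \<Rightarrow> real) \<Rightarrow> bool" where
  "SL_eigensystem p q l \<Lambda> X \<longleftrightarrow>
     (\<forall>i. 0 < \<Lambda> i) \<and> mono \<Lambda> \<and>
     (\<forall>i. SL_eigenfunction p q l (\<Lambda> i) (X i)) \<and>
     complete_orthonormal l X"

text \<open>The function \<open>u\<close> is the solution, in the sense of the Fourier series, of the time-fractional
  diffusion equation of order \<open>\<alpha>\<close> on \<open>(0, l)\<close> with source \<open>F\<close>, initial value \<open>u0\<close> and homogeneous
  Dirichlet conditions; the elliptic operator enters through its eigensystem \<open>\<Lambda>\<close>, \<open>X\<close>. The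
  \<open>L2\<close> and integrability conditions make all the coefficients meaningful, as
  Bochner integrals of non-integrable functions are 0 by convention.\<close>

definition fourier_solution ::
    "real \<Rightarrow> real \<Rightarrow> (nat \<Rightarrow> real) \<Rightarrow> (nat \<Rightarrow> real \<Rightarrow> real) \<Rightarrow>
     (real \<Rightarrow> real) \<Rightarrow> (real \<Rightarrow> real \<Rightarrow> real) \<Rightarrow> (real \<Rightarrow> real \<Rightarrow> real) \<Rightarrow> bool" where
  "fourier_solution \<alpha> l \<Lambda> X u0 F u \<longleftrightarrow>
     L2 l u0 \<and> (\<forall>t>0. L2 l (\<lambda>x. F x t)) \<and>
     (\<forall>i. \<forall>t\<ge>0. integrable (lebesgue_on {0..t})
        (\<lambda>\<tau>. \<tau> powr (\<alpha> - 1) * mittag_leffler \<alpha> \<alpha> (- \<Lambda> i * \<tau> powr \<alpha>) *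
             inner_L2 l (\<lambda>y. F y (t - \<tau>)) (X i))) \<and>
     (\<forall>x\<in>{0..l}. \<forall>t\<ge>0.
        (\<lambda>i. (inner_L2 l u0 (X i) * mittag_leffler \<alpha> 1 (- \<Lambda> i * t powr \<alpha>) +
              (LINT \<tau>|lebesgue_on {0..t}.
                 \<tau> powr (\<alpha> - 1) * mittag_leffler \<alpha> \<alpha> (- \<Lambda> i * \<tau> powr \<alpha>) *
                 inner_L2 l (\<lambda>y. F y (t - \<tau>)) (X i))) * X i x)
        sums u x t)"

end

theory Submission
  imports Defs
begin

text \<open>
  Everything in the time variable is a computation with formal power series. To a power series
  \<open>A = \<Sum>n. a\<^sub>n X\<^sup>n\<close> of positive radius of convergence and to \<open>\<gamma>\<close> belongs the function
  \<open>\<Sum>n. a\<^sub>n t powr (\<alpha> n + \<gamma> - 1) / \<Gamma> (\<alpha> n + \<gamma>)\<close>, whose Laplace transform is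
  \<open>s powr (-\<gamma>) * A (s powr (-\<alpha>))\<close>; it is \<open>ml_kernel \<alpha> \<gamma> A t\<close>. By Euler's Beta integral,
  convolution on \<open>[0, t]\<close> multiplies the power series and adds the parameters \<open>\<gamma>\<close>
  (\<open>ml_kernel_convolution\<close>). Mittag-Leffler functions come from the geometric series
  \<open>1 / (1 + c X)\<close>. So if an eigenfunction with eigenvalue \<open>\<mu>\<close> is excited by \<open>\<psi>\<close>, its amplitude is
  the function belonging to \<open>1 / ((1 + \<mu> X) (1 + \<kappa> X))\<close>, with \<open>\<kappa>\<close> the decay rate of the source, and
  the two explicit formulas are partial fractions for \<open>\<kappa> \<noteq> \<mu>\<close>, and the Euler operator
  \<open>X d/dX\<close> applied to \<open>1 / (1 + \<mu> X)\<close> for \<open>\<kappa> = \<mu>\<close>.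

  For the asymptotics, the recurrence
  \<open>y * E\<^sub>\<alpha>\<^sub>,\<^sub>\<gamma>\<^sub>+\<^sub>\<alpha> (-y) = 1 / \<Gamma> \<gamma> - E\<^sub>\<alpha>\<^sub>,\<^sub>\<gamma> (-y)\<close> gains one factor \<open>1 / y\<close> per step, and a second
  one if \<open>\<gamma>\<close> is a pole of \<open>\<Gamma>\<close>; the latter is what happens for \<open>\<alpha> = \<beta>\<close>. It only remains to
  show that \<open>E\<^sub>\<alpha>\<^sub>,\<^sub>\<gamma>\<close> is bounded on the negative axis for \<^emph>\<open>every\<close> real \<open>\<gamma>\<close>, also for
  negative ones (\<open>mittag_leffler_bounded\<close>). The function
  \<open>e t = t powr (\<alpha> - 1) * E\<^sub>\<alpha>\<^sub>,\<^sub>\<alpha> (- t powr \<alpha>)\<close> is the resolvent of the kernel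
  \<open>k t = t powr (\<alpha> - 1) / \<Gamma> \<alpha>\<close>, that is, \<open>e + k * e = k\<close>. As \<open>k\<close> is log-convex, \<open>e\<close> cannot have
  a first zero (\<open>resolvent_pos\<close>), and as \<open>k\<close> decreases, \<open>e\<close> has total mass at most 1. Hence the
  functions belonging to \<open>\<gamma> = 1\<close> and to the powers of \<open>w = X / (1 + X)\<close>, which are iterated
  convolutions with \<open>e\<close>, take values in \<open>[0, 1]\<close>. A fractional integration carries the bound to
  \<open>\<gamma> > 1\<close>, and from \<open>\<gamma>\<close> one gets down to \<open>\<gamma> - 1\<close> by a differentiation, which acts on the
  power series as the Euler operator and maps \<open>w ^ k\<close> to \<open>k (w ^ k - w ^ (k + 1))\<close>. Finally
  \<open>1 / (1 + X) = 1 - w\<close>.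

  In the space variable one only needs that the eigenspaces are one-dimensional
  (\<open>SL_eigenspace_one_dimensional\<close>), by uniqueness for the initial value problem. Then \<open>Xk\<close> is a
  multiple of \<open>X k\<close> and only one term of the Fourier series survives.
\<close>

section \<open>Decay of the reciprocal Gamma function\<close>

text \<open>Restrict Euler's integral for \<open>\<Gamma> z\<close> to \<open>[R, R + 1]\<close>. As \<open>R\<close> is free, the reciprocal
  Gamma function decays faster than every exponential, without Stirling's formula.\<close>

lemma rGamma_le_exp_powr:
  fixes R z :: real
  assumes R: "R \<ge> 1" and z: "z \<ge> 1"
  shows "0 \<le> rGamma z" "rGamma z \<le> exp (R + 1) * R powr (1 - z)"
proof -
  have pos: "Gamma z > 0" using z by (intro Gamma_real_pos) auto
  show "0 \<le> rGamma z" using pos by (simp add: rGamma_inverse_Gamma)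
  have "R powr (z - 1) / exp (R + 1) \<le> Gamma z"
  proof (rule has_integral_le)
    have "((\<lambda>t. R powr (z - 1) / exp (R + 1)) has_integral (R powr (z - 1) / exp (R + 1))) {R..R+1}"
      using has_integral_const_real[of "R powr (z - 1) / exp (R + 1)" R "R + 1"] by simp
    then show "((\<lambda>t. if t \<in> {R..R+1} then R powr (z - 1) / exp (R + 1) else 0)
        has_integral (R powr (z - 1) / exp (R + 1))) {0..}"
      using R by (subst has_integral_restrict) auto
    show "((\<lambda>t. t powr (z - 1) / exp t) has_integral Gamma z) {0..}"
      using z by (intro Gamma_integral_real) auto
  qed (use R z in \<open>auto intro!: frac_le powr_mono2\<close>)
  then have "1 / Gamma z \<le> 1 / (R powr (z - 1) / exp (R + 1))"
    using R pos by (intro divide_left_mono mult_pos_pos divide_pos_pos) auto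
  also have "\<dots> = exp (R + 1) * R powr (1 - z)"
    by (simp add: powr_diff)
  finally show "rGamma z \<le> exp (R + 1) * R powr (1 - z)"
    by (simp add: rGamma_inverse_Gamma inverse_eq_divide)
qed

lemma summable_power_rGamma:
  fixes \<alpha> \<gamma> z :: real
  assumes \<alpha>: "\<alpha> > 0"
  shows "summable (\<lambda>n. \<bar>z ^ n * rGamma (\<alpha> * real n + \<gamma>)\<bar>)"
proof -
  \<comment> \<open>With \<open>R powr \<alpha> > 2 * \<bar>z\<bar>\<close> the terms are dominated by a geometric series.\<close>
  define R where "R = (2 * \<bar>z\<bar> + 1) powr (1 / \<alpha>)"
  have R1: "R \<ge> 1" unfolding R_def using \<alpha> by (intro ge_one_powr_ge_zero) auto
  have Ra: "R powr \<alpha> = 2 * \<bar>z\<bar> + 1" using \<alpha> by (simp add: R_def powr_powr)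
  define q where "q = \<bar>z\<bar> / (2 * \<bar>z\<bar> + 1)"
  have q: "0 \<le> q" "q < 1" by (auto simp: q_def field_simps)
  \<comment> \<open>From \<open>N\<close> on the argument of the Gamma function is at least 1.\<close>
  obtain N :: nat where N: "real N \<ge> (1 - \<gamma>) / \<alpha>" using real_arch_simple by blast
  show ?thesis
  proof (rule summable_comparison_test_ev)
    show "summable (\<lambda>n. exp (R + 1) * R powr (1 - \<gamma>) * q ^ n)"
      using q by (intro summable_mult summable_geometric) auto
    show "\<forall>\<^sub>F n in sequentially. norm \<bar>z ^ n * rGamma (\<alpha> * real n + \<gamma>)\<bar>
        \<le> exp (R + 1) * R powr (1 - \<gamma>) * q ^ n"
      using eventually_ge_at_top[of N]
    proof eventually_elim
      fix n assume n: "n \<ge> N"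
      have "(1 - \<gamma>) / \<alpha> \<le> real n" using N n by linarith
      then have ge1: "\<alpha> * real n + \<gamma> \<ge> 1" using \<alpha> by (simp add: field_simps)
      have "norm \<bar>z ^ n * rGamma (\<alpha> * real n + \<gamma>)\<bar> = \<bar>z\<bar> ^ n * rGamma (\<alpha> * real n + \<gamma>)"
        using rGamma_le_exp_powr(1)[OF R1 ge1] by (simp add: abs_mult power_abs)
      also have "\<dots> \<le> \<bar>z\<bar> ^ n * (exp (R + 1) * R powr (1 - (\<alpha> * real n + \<gamma>)))"
        using rGamma_le_exp_powr(2)[OF R1 ge1] by (intro mult_left_mono) auto
      also have "R powr (1 - (\<alpha> * real n + \<gamma>)) = R powr (1 - \<gamma>) / (R powr \<alpha>) ^ n"
        using R1 by (simp add: powr_diff powr_add powr_powr powr_realpow [symmetric])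
      also have "\<bar>z\<bar> ^ n * (exp (R + 1) * (R powr (1 - \<gamma>) / (R powr \<alpha>) ^ n)) =
          exp (R + 1) * R powr (1 - \<gamma>) * q ^ n"
        by (simp add: Ra q_def power_divide)
      finally show "norm \<bar>z ^ n * rGamma (\<alpha> * real n + \<gamma>)\<bar> \<le> exp (R + 1) * R powr (1 - \<gamma>) * q ^ n" .
    qed
  qed
qed

section \<open>Mittag-Leffler transform of a power series\<close>

text \<open>This is the Borel-type transform that divides the \<open>n\<close>-th coefficient by \<open>\<Gamma> (\<alpha> n + \<gamma>)\<close>.
  Keeping the power series as an argument, instead of only treating Mittag-Leffler
  functions, makes products of power series available for convolutions.\<close>

definition ml_transform :: "real \<Rightarrow> real \<Rightarrow> real fps \<Rightarrow> real \<Rightarrow> real" where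
  "ml_transform \<alpha> \<gamma> A x = (\<Sum>n. fps_nth A n * rGamma (\<alpha> * real n + \<gamma>) * x ^ n)"

lemma summable_ml_transform:
  assumes \<alpha>: "\<alpha> > 0" and A: "fps_conv_radius A > 0"
  shows "summable (\<lambda>n. \<bar>fps_nth A n * rGamma (\<alpha> * real n + \<gamma>) * x ^ n\<bar>)"
proof -
  obtain r where r: "0 < r" "ereal r < fps_conv_radius A"
    using ereal_dense2[OF A] by (auto simp: zero_ereal_def)
  have "summable (\<lambda>n. norm (fps_nth A n * r ^ n))"
    using r by (intro abs_summable_in_conv_radius) (auto simp: fps_conv_radius_def)
  then have "Bseq (\<lambda>n. norm (fps_nth A n * r ^ n))"
    by (intro convergent_imp_Bseq summable_LIMSEQ_zero[THEN convergentI])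
  then obtain M where M: "M > 0" "\<And>n. \<bar>fps_nth A n\<bar> * r ^ n \<le> M"
    using r by (auto simp: Bseq_def abs_mult)
  show ?thesis
  proof (rule summable_comparison_test)
    show "summable (\<lambda>n. M * \<bar>(x / r) ^ n * rGamma (\<alpha> * real n + \<gamma>)\<bar>)"
      using \<alpha> by (intro summable_mult summable_power_rGamma)
    have "\<bar>fps_nth A n * rGamma (\<alpha> * real n + \<gamma>) * x ^ n\<bar> \<le> M * \<bar>(x / r) ^ n * rGamma (\<alpha> * real n + \<gamma>)\<bar>" for n
    proof -
      have "\<bar>fps_nth A n * rGamma (\<alpha> * real n + \<gamma>) * x ^ n\<bar> =
          (\<bar>fps_nth A n\<bar> * r ^ n) * \<bar>(x / r) ^ n * rGamma (\<alpha> * real n + \<gamma>)\<bar>"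
        using r by (simp add: abs_mult power_divide)
      also have "\<dots> \<le> M * \<bar>(x / r) ^ n * rGamma (\<alpha> * real n + \<gamma>)\<bar>"
        using M by (intro mult_right_mono) auto
      finally show ?thesis .
    qed
    then show "\<exists>N. \<forall>n\<ge>N. norm \<bar>fps_nth A n * rGamma (\<alpha> * real n + \<gamma>) * x ^ n\<bar>
        \<le> M * \<bar>(x / r) ^ n * rGamma (\<alpha> * real n + \<gamma>)\<bar>" by simp
  qed
qed

lemma sums_ml_transform:
  assumes "\<alpha> > 0" "fps_conv_radius A > 0"
  shows "(\<lambda>n. fps_nth A n * rGamma (\<alpha> * real n + \<gamma>) * x ^ n) sums ml_transform \<alpha> \<gamma> A x"
  unfolding ml_transform_def
  using summable_rabs_cancel[OF summable_ml_transform[OF assms]] by (rule summable_sums)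

lemma isCont_ml_transform:
  assumes "\<alpha> > 0" "fps_conv_radius A > 0"
  shows "isCont (ml_transform \<alpha> \<gamma> A) x"
  unfolding ml_transform_def
  by (rule isCont_powser_converges_everywhere)
     (use summable_rabs_cancel[OF summable_ml_transform[OF assms]] in simp)

lemma ml_transform_0 [simp]: "ml_transform \<alpha> \<gamma> A 0 = fps_nth A 0 * rGamma \<gamma>"
  unfolding ml_transform_def
  using powser_zero[of "\<lambda>n. fps_nth A n * rGamma (\<alpha> * real n + \<gamma>)"] by simp

lemma ml_transform_add:
  assumes "\<alpha> > 0" "fps_conv_radius A > 0" "fps_conv_radius B > 0"
  shows "ml_transform \<alpha> \<gamma> (A + B) x = ml_transform \<alpha> \<gamma> A x + ml_transform \<alpha> \<gamma> B x"
  using sums_add[OF sums_ml_transform[OF assms(1,2), of \<gamma> x] sums_ml_transform[OF assms(1,3), of \<gamma> x]]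
  by (simp add: ml_transform_def sums_iff algebra_simps)

lemma ml_transform_cmult:
  assumes "\<alpha> > 0" "fps_conv_radius A > 0"
  shows "ml_transform \<alpha> \<gamma> (fps_const c * A) x = c * ml_transform \<alpha> \<gamma> A x"
  using sums_mult[OF sums_ml_transform[OF assms, of \<gamma> x], of c]
  by (simp add: ml_transform_def sums_iff algebra_simps)

lemma ml_transform_const: "ml_transform \<alpha> \<gamma> (fps_const c) x = c * rGamma \<gamma>"
proof -
  have "(\<lambda>n. fps_nth (fps_const c) n * rGamma (\<alpha> * real n + \<gamma>) * x ^ n) sums
      (\<Sum>n\<in>{0}. fps_nth (fps_const c) n * rGamma (\<alpha> * real n + \<gamma>) * x ^ n)"
    by (rule sums_finite) auto
  then show ?thesis by (simp add: ml_transform_def sums_iff)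
qed

lemma ml_transform_X_mult:
  assumes "\<alpha> > 0" "fps_conv_radius A > 0"
  shows "ml_transform \<alpha> \<gamma> (fps_X * A) x = x * ml_transform \<alpha> (\<gamma> + \<alpha>) A x"
proof -
  have eq: "x * (fps_nth A n * rGamma (\<alpha> * real n + (\<gamma> + \<alpha>)) * x ^ n) =
     fps_nth (fps_X * A) (Suc n) * rGamma (\<alpha> * real (Suc n) + \<gamma>) * x ^ Suc n" for n
    by (simp add: algebra_simps)
  have "(\<lambda>n. fps_nth (fps_X * A) (Suc n) * rGamma (\<alpha> * real (Suc n) + \<gamma>) * x ^ Suc n) sums
      (x * ml_transform \<alpha> (\<gamma> + \<alpha>) A x)"
    using sums_mult[OF sums_ml_transform[OF assms, of "\<gamma> + \<alpha>" x], of x] unfolding eq .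
  from sums_Suc[OF this] show ?thesis by (simp add: ml_transform_def sums_iff)
qed

text \<open>Since \<open>1 / \<Gamma> (z - 1) = (z - 1) / \<Gamma> z\<close>, lowering \<open>\<gamma>\<close> by one multiplies the \<open>n\<close>-th
  coefficient by a linear function of \<open>n\<close>, which is what the Euler operator does. In terms
  of kernels this is differentiation in \<open>t\<close>.\<close>

lemma ml_transform_lower:
  assumes \<alpha>: "\<alpha> > 0" and A: "fps_conv_radius A > 0"
  shows "ml_transform \<alpha> (\<gamma> - 1) A x =
    ml_transform \<alpha> \<gamma> (fps_const \<alpha> * fps_XD A) x + (\<gamma> - 1) * ml_transform \<alpha> \<gamma> A x"
proof -
  have eq: "fps_nth (fps_const \<alpha> * fps_XD A) n * rGamma (\<alpha> * real n + \<gamma>) * x ^ n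
      = fps_nth A n * rGamma (\<alpha> * real n + (\<gamma> - 1)) * x ^ n
        - (\<gamma> - 1) * (fps_nth A n * rGamma (\<alpha> * real n + \<gamma>) * x ^ n)" for n
  proof -
    have "rGamma (\<alpha> * real n + (\<gamma> - 1)) =
        (\<alpha> * real n + (\<gamma> - 1)) * rGamma (\<alpha> * real n + \<gamma>)"
      using rGamma_plus1[of "\<alpha> * real n + (\<gamma> - 1)"] by (simp add: add.assoc)
    then show ?thesis
      unfolding fps_mult_left_const_nth fps_XD_nth by (simp only:) (simp add: algebra_simps)
  qed
  have "(\<lambda>n. fps_nth (fps_const \<alpha> * fps_XD A) n * rGamma (\<alpha> * real n + \<gamma>) * x ^ n) sums
     (ml_transform \<alpha> (\<gamma> - 1) A x - (\<gamma> - 1) * ml_transform \<alpha> \<gamma> A x)"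
    unfolding eq
    by (intro sums_diff sums_mult sums_ml_transform assms)
  then show ?thesis by (simp add: ml_transform_def sums_iff)
qed

lemma fps_conv_radius_mult_pos:
  fixes A B :: "real fps"
  assumes "fps_conv_radius A > 0" "fps_conv_radius B > 0"
  shows "fps_conv_radius (A * B) > 0"
  using assms fps_conv_radius_mult[of A B] by (simp add: min_def split: if_splits)

lemma fps_conv_radius_one_pos [simp]: "fps_conv_radius (1 :: real fps) > 0"
  by simp

definition geom :: "real \<Rightarrow> real fps" where
  "geom c = Abs_fps (\<lambda>n. (- c) ^ n)"

lemma fps_nth_geom [simp]: "fps_nth (geom c) n = (- c) ^ n"
  by (simp add: geom_def)

text \<open>The equation \<open>(1 + c X) * geom c = 1\<close>, in a form to which additivity and the rule for
  multiplication by \<open>X\<close> apply.\<close>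

lemma geom_recurrence: "geom c + fps_const c * (fps_X * geom c) = 1"
  unfolding fps_eq_iff
proof
  fix n show "fps_nth (geom c + fps_const c * (fps_X * geom c)) n = fps_nth 1 n"
    by (cases n) simp_all
qed

lemma fps_conv_radius_geom: "fps_conv_radius (geom c) > 0"
proof -
  have "summable (\<lambda>n. (- c / (\<bar>c\<bar> + 1)) ^ n)"
    by (intro summable_geometric) (auto simp: field_simps)
  then have "summable (\<lambda>n. fps_nth (geom c) n * (1 / (\<bar>c\<bar> + 1)) ^ n)"
    by (simp only: fps_nth_geom flip: power_mult_distrib) simp
  then have "fps_conv_radius (geom c) \<ge> norm (1 / (\<bar>c\<bar> + 1))"
    unfolding fps_conv_radius_def by (rule conv_radius_geI)
  moreover have "ereal (norm (1 / (\<bar>c\<bar> + 1))) > 0"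
    by simp
  ultimately show ?thesis by (rule less_le_trans[rotated])
qed

lemma mittag_leffler_conv_transform:
  "mittag_leffler \<alpha> \<gamma> (- c * x) = ml_transform \<alpha> \<gamma> (geom c) x"
  unfolding mittag_leffler_def ml_transform_def
  by (intro suminf_cong) (simp only: fps_nth_geom power_mult_distrib ac_simps)

section \<open>Convolution of Mittag-Leffler kernels\<close>

text \<open>Its Laplace transform is \<open>s powr (-\<gamma>) * A (s powr (-\<alpha>))\<close>.\<close>

definition ml_kernel :: "real \<Rightarrow> real \<Rightarrow> real fps \<Rightarrow> real \<Rightarrow> real" where
  "ml_kernel \<alpha> \<gamma> A t = t powr (\<gamma> - 1) * ml_transform \<alpha> \<gamma> A (t powr \<alpha>)"

text \<open>The kernel of the Riemann-Liouville integral of order \<open>\<gamma>\<close>.\<close>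

abbreviation frac_power :: "real \<Rightarrow> real \<Rightarrow> real" where
  "frac_power \<gamma> t \<equiv> t powr (\<gamma> - 1) * rGamma \<gamma>"

lemma frac_power_nonneg: "\<gamma> > 0 \<Longrightarrow> 0 \<le> frac_power \<gamma> t"
  using Gamma_real_pos[of \<gamma>] by (simp add: rGamma_inverse_Gamma less_imp_le)

text \<open>True also at \<open>t = 0\<close>, where both sides are 0 because \<open>0 powr a = 0\<close>.\<close>

lemma powr_power_shift: "t powr (\<gamma> - 1) * (t powr \<alpha>) ^ n = t powr (\<alpha> * real n + \<gamma> - 1)"
proof (cases "t = 0")
  case False
  then have "(t powr \<alpha>) ^ n = t powr (\<alpha> * real n)"
    by (simp add: powr_power mult.commute)
  then show ?thesis using False by (simp add: powr_add [symmetric] algebra_simps)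
qed auto

lemma sums_ml_kernel:
  assumes "\<alpha> > 0" "fps_conv_radius A > 0"
  shows "(\<lambda>n. fps_nth A n * frac_power (\<alpha> * real n + \<gamma>) t) sums ml_kernel \<alpha> \<gamma> A t"
    and "summable (\<lambda>n. norm (fps_nth A n * frac_power (\<alpha> * real n + \<gamma>) t))"
proof -
  have eq: "t powr (\<gamma> - 1) * (fps_nth A n * rGamma (\<alpha> * real n + \<gamma>) * (t powr \<alpha>) ^ n) =
      fps_nth A n * frac_power (\<alpha> * real n + \<gamma>) t" for n
    by (simp flip: powr_power_shift)
  show "(\<lambda>n. fps_nth A n * frac_power (\<alpha> * real n + \<gamma>) t) sums ml_kernel \<alpha> \<gamma> A t"
    using sums_mult[OF sums_ml_transform[OF assms, of \<gamma> "t powr \<alpha>"], of "t powr (\<gamma> - 1)"]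
    by (simp only: eq ml_kernel_def)
  have "summable (\<lambda>n. \<bar>t powr (\<gamma> - 1)\<bar> *
      \<bar>fps_nth A n * rGamma (\<alpha> * real n + \<gamma>) * (t powr \<alpha>) ^ n\<bar>)"
    by (intro summable_mult summable_ml_transform assms)
  then show "summable (\<lambda>n. norm (fps_nth A n * frac_power (\<alpha> * real n + \<gamma>) t))"
    by (simp only: abs_mult [symmetric] eq real_norm_def)
qed

lemma ml_kernel_one: "ml_kernel \<alpha> \<gamma> 1 t = frac_power \<gamma> t"
  using ml_transform_const[of \<alpha> \<gamma> 1] by (simp add: ml_kernel_def)

lemma ml_kernel_X_mult:
  assumes "\<alpha> > 0" "fps_conv_radius A > 0"
  shows "ml_kernel \<alpha> \<gamma> (fps_X * A) t = ml_kernel \<alpha> (\<gamma> + \<alpha>) A t"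
proof -
  have "t powr (\<gamma> - 1) * t powr \<alpha> = t powr (\<gamma> + \<alpha> - 1)"
    unfolding powr_add [symmetric] by (simp add: algebra_simps)
  then show ?thesis
    unfolding ml_kernel_def ml_transform_X_mult[OF assms] by (simp flip: mult.assoc)
qed

lemma continuous_on_ml_kernel:
  assumes "\<alpha> > 0" "fps_conv_radius A > 0"
  shows "continuous_on {0<..} (ml_kernel \<alpha> \<gamma> A)"
proof -
  have "continuous_on UNIV (ml_transform \<alpha> \<gamma> A)"
    by (intro continuous_at_imp_continuous_on ballI isCont_ml_transform assms)
  moreover have "continuous_on {0<..} (\<lambda>t :: real. t powr \<alpha>)"
    by (intro continuous_intros) auto
  ultimately have "continuous_on {0<..} (\<lambda>t. ml_transform \<alpha> \<gamma> A (t powr \<alpha>))"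
    by (rule continuous_on_compose2) auto
  moreover have "continuous_on {0<..} (\<lambda>t :: real. t powr (\<gamma> - 1))"
    by (intro continuous_intros) auto
  ultimately show ?thesis
    unfolding ml_kernel_def by (intro continuous_on_mult)
qed

text \<open>Euler's Beta integral, rescaled from \<open>[0, 1]\<close> to \<open>[0, t]\<close>.\<close>

lemma frac_power_convolution:
  fixes a b t :: real
  assumes a: "a > 0" and b: "b > 0" and t: "t > 0"
  shows "has_bochner_integral (lebesgue_on {0..t})
    (\<lambda>s. frac_power a s * frac_power b (t - s)) (frac_power (a + b) t)"
proof -
  have "((\<lambda>s. (s / t) powr (a - 1) * (1 - s / t) powr (b - 1)) has_integral (t * Beta a b)) {0..t}"
  proof -
    have "(\<lambda>x. t * x) ` {0..1} = {0..t}"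
      using t image_mult_atLeastAtMost[of t 0 1] by simp
    moreover have "(\<lambda>x. x / (1 / t)) = (\<lambda>x. t * x)" by auto
    ultimately have "(\<lambda>x. x / (1 / t)) ` {0..1} = {0..t}" by (simp only:)
    then show ?thesis
      using has_integral_stretch_real[OF has_integral_Beta_real[OF a b], of "1 / t"] t
      by (simp del: divide_divide_eq_right)
  qed
  from has_integral_mult_right[OF this, of "t powr (a + b - 2) * rGamma a * rGamma b"]
  have "((\<lambda>s. t powr (a + b - 2) * rGamma a * rGamma b *
        ((s / t) powr (a - 1) * (1 - s / t) powr (b - 1)))
      has_integral (t powr (a + b - 2) * rGamma a * rGamma b * (t * Beta a b))) {0..t}" .
  also have "t powr (a + b - 2) * rGamma a * rGamma b * (t * Beta a b) = frac_power (a + b) t"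
  proof -
    have "t powr (a + b - 2) * t = t powr (a + b - 1)"
      using t powr_mult_base[of t "a + b - 2"] by (simp add: mult.commute)
    moreover have "rGamma a * rGamma b * Beta a b = rGamma (a + b)"
      using Gamma_real_pos[OF a] Gamma_real_pos[OF b]
      by (simp add: Beta_altdef rGamma_inverse_Gamma field_simps)
    ultimately show ?thesis
      by (metis (no_types, opaque_lifting) mult.assoc mult.left_commute)
  qed
  finally have "((\<lambda>s. frac_power a s * frac_power b (t - s)) has_integral frac_power (a + b) t) {0..t}"
  proof (rule has_integral_eq[rotated])
    fix s assume s: "s \<in> {0..t}"
    have "1 - s / t = (t - s) / t" using t by (simp add: field_simps)
    then have "(s / t) powr (a - 1) * (1 - s / t) powr (b - 1) =
        s powr (a - 1) * (t - s) powr (b - 1) / (t powr (a - 1) * t powr (b - 1))"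
      using s t by (simp add: powr_divide)
    also have "t powr (a - 1) * t powr (b - 1) = t powr (a + b - 2)"
      by (simp add: powr_add [symmetric])
    finally show "t powr (a + b - 2) * rGamma a * rGamma b *
        ((s / t) powr (a - 1) * (1 - s / t) powr (b - 1)) = frac_power a s * frac_power b (t - s)"
      using t by simp
  qed
  note int = this
  have "(\<lambda>s. frac_power a s * frac_power b (t - s)) absolutely_integrable_on {0..t}"
    using int a b by (intro nonnegative_absolutely_integrable_1 mult_nonneg_nonneg frac_power_nonneg)
      (auto simp: integrable_on_def)
  then have "integrable (lebesgue_on {0..t}) (\<lambda>s. frac_power a s * frac_power b (t - s))"
    by (intro absolutely_integrable_imp_integrable) auto
  moreover from this have "(LINT s|lebesgue_on {0..t}. frac_power a s * frac_power b (t - s)) =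
      frac_power (a + b) t"
    by (subst lebesgue_integral_eq_integral) (auto intro: integral_unique[OF int])
  ultimately show ?thesis
    unfolding has_bochner_integral_iff by blast
qed

text \<open>Multiply the two series by Cauchy's rule and integrate term by term: every summand of
  the \<open>n\<close>-th Cauchy term has the same convolution, as the exponents add up to
  \<open>\<alpha> n + \<gamma> + \<delta> - 1\<close>. Term-by-term integration is justified by the same computation for the
  absolute values of the coefficients.\<close>

proposition ml_kernel_convolution:
  assumes \<alpha>: "\<alpha> > 0" and A: "fps_conv_radius A > 0" and B: "fps_conv_radius B > 0"
    and \<gamma>: "\<gamma> > 0" and \<delta>: "\<delta> > 0" and t: "t \<ge> 0"
  shows "has_bochner_integral (lebesgue_on {0..t})
    (\<lambda>s. ml_kernel \<alpha> \<gamma> A s * ml_kernel \<alpha> \<delta> B (t - s)) (ml_kernel \<alpha> (\<gamma> + \<delta>) (A * B) t)"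
proof (cases "t = 0")
  case True
  have "has_bochner_integral (lebesgue_on {0..t})
      (\<lambda>s. ml_kernel \<alpha> \<gamma> A s * ml_kernel \<alpha> \<delta> B (t - s)) 0 \<longleftrightarrow>
      has_bochner_integral (lebesgue_on {0..t}) (\<lambda>s. 0 :: real) 0"
    by (rule has_bochner_integral_cong) (auto simp: True ml_kernel_def)
  then show ?thesis using True by (simp add: ml_kernel_def)
next
  case False
  with t have t: "t > 0" by simp
  define M where "M = lebesgue_on {0..t}"
  define h where "h n i s = frac_power (\<alpha> * real i + \<gamma>) s * frac_power (\<alpha> * real (n - i) + \<delta>) (t - s)" for n i s
  define f where "f n s = (\<Sum>i\<le>n. (fps_nth A i * fps_nth B (n - i)) * h n i s)" for n s
  have f_alt: "f n s = (\<Sum>i\<le>n. (fps_nth A i * frac_power (\<alpha> * real i + \<gamma>) s) *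
      (fps_nth B (n - i) * frac_power (\<alpha> * real (n - i) + \<delta>) (t - s)))" for n s
    unfolding f_def h_def by (intro sum.cong) auto
  have h: "has_bochner_integral M (h n i) (frac_power (\<alpha> * real n + (\<gamma> + \<delta>)) t)" if "i \<le> n" for n i
  proof -
    have "has_bochner_integral M (h n i)
       (frac_power ((\<alpha> * real i + \<gamma>) + (\<alpha> * real (n - i) + \<delta>)) t)"
      unfolding M_def h_def using \<alpha> \<gamma> \<delta> t
      by (intro frac_power_convolution add_nonneg_pos mult_nonneg_nonneg) auto
    also have "(\<alpha> * real i + \<gamma>) + (\<alpha> * real (n - i) + \<delta>) = \<alpha> * real n + (\<gamma> + \<delta>)"
      using that by (simp add: of_nat_diff algebra_simps)
    finally show ?thesis .
  qed
  have h_nonneg: "h n i s \<ge> 0" for n i s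
    unfolding h_def using \<alpha> \<gamma> \<delta>
    by (intro mult_nonneg_nonneg frac_power_nonneg add_nonneg_pos) auto
  define g where "g n s = (\<Sum>i\<le>n. \<bar>fps_nth A i * fps_nth B (n - i)\<bar> * h n i s)" for n s
  define c where "c n = (\<Sum>i\<le>n. \<bar>fps_nth A i\<bar> * \<bar>fps_nth B (n - i)\<bar>)" for n
  have fM: "has_bochner_integral M (f n) (fps_nth (A * B) n * frac_power (\<alpha> * real n + (\<gamma> + \<delta>)) t)" for n
  proof -
    have "has_bochner_integral M (f n)
        (\<Sum>i\<le>n. (fps_nth A i * fps_nth B (n - i)) * frac_power (\<alpha> * real n + (\<gamma> + \<delta>)) t)"
      unfolding f_def by (intro has_bochner_integral_sum has_bochner_integral_mult_right h) auto
    then show ?thesis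
      by (simp add: fps_mult_nth atLeast0AtMost sum_distrib_right)
  qed
  have gM: "has_bochner_integral M (g n) (c n * frac_power (\<alpha> * real n + (\<gamma> + \<delta>)) t)" for n
  proof -
    have "has_bochner_integral M (g n)
        (\<Sum>i\<le>n. \<bar>fps_nth A i * fps_nth B (n - i)\<bar> * frac_power (\<alpha> * real n + (\<gamma> + \<delta>)) t)"
      unfolding g_def by (intro has_bochner_integral_sum has_bochner_integral_mult_right h) auto
    then show ?thesis
      by (simp add: c_def abs_mult sum_distrib_right)
  qed
  have fg: "norm (f n s) \<le> g n s" for n s
    unfolding f_def g_def real_norm_def
    by (rule order_trans[OF sum_abs]) (simp add: abs_mult h_nonneg)
  have norm_int: "(\<integral>s. norm (f n s) \<partial>M) \<le> c n * frac_power (\<alpha> * real n + (\<gamma> + \<delta>)) t" for n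
  proof -
    have "(\<integral>s. norm (f n s) \<partial>M) \<le> (\<integral>s. g n s \<partial>M)"
      using fM gM by (intro integral_mono integrable_norm fg) (auto simp: has_bochner_integral_iff)
    then show ?thesis using gM by (simp add: has_bochner_integral_iff)
  qed
  have summ: "summable (\<lambda>n. norm (f n s))" for s
  proof (rule summable_comparison_test)
    show "\<exists>N. \<forall>n\<ge>N. norm (norm (f n s)) \<le>
        (\<Sum>i\<le>n. norm (fps_nth A i * frac_power (\<alpha> * real i + \<gamma>) s) *
          norm (fps_nth B (n - i) * frac_power (\<alpha> * real (n - i) + \<delta>) (t - s)))"
      unfolding f_alt by (auto intro!: exI[of _ 0] order_trans[OF sum_abs] simp: abs_mult)
    show "summable (\<lambda>n. \<Sum>i\<le>n. norm (fps_nth A i * frac_power (\<alpha> * real i + \<gamma>) s) *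
          norm (fps_nth B (n - i) * frac_power (\<alpha> * real (n - i) + \<delta>) (t - s)))"
      using sums_ml_kernel(2)[OF \<alpha> A, where \<gamma> = \<gamma> and t = s] sums_ml_kernel(2)[OF \<alpha> B, where \<gamma> = \<delta> and t = "t - s"]
      by (intro summable_Cauchy_product) auto
  qed
  have suminf_f: "(\<Sum>n. f n s) = ml_kernel \<alpha> \<gamma> A s * ml_kernel \<alpha> \<delta> B (t - s)" for s
    using Cauchy_product[OF sums_ml_kernel(2)[OF \<alpha> A, where \<gamma> = \<gamma> and t = s] sums_ml_kernel(2)[OF \<alpha> B, where \<gamma> = \<delta> and t = "t - s"]]
      sums_ml_kernel(1)[OF \<alpha> A, where \<gamma> = \<gamma> and t = s] sums_ml_kernel(1)[OF \<alpha> B, where \<gamma> = \<delta> and t = "t - s"]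
    by (simp only: sums_iff f_alt)
  have summ_int: "summable (\<lambda>n. \<integral>s. norm (f n s) \<partial>M)"
  proof (rule summable_comparison_test)
    define A' where "A' = Abs_fps (\<lambda>n. norm (fps_nth A n))"
    define B' where "B' = Abs_fps (\<lambda>n. norm (fps_nth B n))"
    have "fps_conv_radius (A' * B') > 0"
      unfolding A'_def B'_def
      by (rule fps_conv_radius_mult_pos) (use A B in \<open>simp_all only: fps_conv_radius_norm\<close>)
    from sums_ml_kernel(2)[OF \<alpha> this, where \<gamma> = "\<gamma> + \<delta>" and t = t]
    show "summable (\<lambda>n. norm (fps_nth (A' * B') n * frac_power (\<alpha> * real n + (\<gamma> + \<delta>)) t))" .
    have c: "fps_nth (A' * B') n = c n" for n
      by (simp add: fps_mult_nth atLeast0AtMost c_def A'_def B'_def)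
    show "\<exists>N. \<forall>n\<ge>N. norm (\<integral>s. norm (f n s) \<partial>M) \<le>
       norm (fps_nth (A' * B') n * frac_power (\<alpha> * real n + (\<gamma> + \<delta>)) t)"
      unfolding c using order_trans[OF norm_int abs_ge_self] by (auto intro!: exI[of _ 0])
  qed
  have fi: "integrable M (f n)" for n using fM by (simp add: has_bochner_integral_iff)
  have "integrable M (\<lambda>s. \<Sum>n. f n s)"
    using fi summ summ_int by (intro integrable_suminf) auto
  moreover have "(\<integral>s. (\<Sum>n. f n s) \<partial>M) = (\<Sum>n. integral\<^sup>L M (f n))"
    using fi summ summ_int by (intro integral_suminf) auto
  moreover have "(\<Sum>n. integral\<^sup>L M (f n)) = ml_kernel \<alpha> (\<gamma> + \<delta>) (A * B) t"
  proof -
    have "fps_conv_radius (A * B) > 0"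
      using A B by (rule fps_conv_radius_mult_pos)
    from sums_ml_kernel(1)[OF \<alpha> this, where \<gamma> = "\<gamma> + \<delta>" and t = t] show ?thesis
      using fM by (simp add: has_bochner_integral_iff sums_iff)
  qed
  ultimately show ?thesis
    by (simp add: has_bochner_integral_iff suminf_f M_def)
qed

section \<open>Positivity of the resolvent of the fractional integral\<close>

lemma has_integral_of_bochner:
  fixes f :: "real \<Rightarrow> real"
  assumes "has_bochner_integral (lebesgue_on {a..b}) f I"
  shows "(f has_integral I) {a..b}"
  using has_integral_integral_lebesgue_on[of "{a..b}" f] assms by (simp add: has_bochner_integral_iff)

lemma has_integral_powr_reflected:
  fixes \<alpha> a b :: real
  assumes \<alpha>: "\<alpha> > 0" and ab: "a \<le> b"
  shows "((\<lambda>s. (b - s) powr (\<alpha> - 1)) has_integral ((b - a) powr \<alpha> / \<alpha>)) {a..b}"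
proof -
  have "((\<lambda>s. (b - s) powr (\<alpha> - 1)) has_integral (- ((b - b) powr \<alpha> / \<alpha>) - (- ((b - a) powr \<alpha> / \<alpha>)))) {a..b}"
  proof (rule fundamental_theorem_of_calculus_interior[OF ab])
    show "continuous_on {a..b} (\<lambda>s. - ((b - s) powr \<alpha> / \<alpha>))"
      using \<alpha> by (intro continuous_intros continuous_on_powr') auto
    show "((\<lambda>s. - ((b - s) powr \<alpha> / \<alpha>)) has_vector_derivative (b - s) powr (\<alpha> - 1)) (at s)"
      if "s \<in> {a<..<b}" for s
      using that \<alpha>
      by (auto intro!: derivative_eq_intros simp flip: has_real_derivative_iff_has_vector_derivative)
  qed
  then show ?thesis by simp
qed

text \<open>The function \<open>t powr (\<alpha> - 1) * E\<^sub>\<alpha>\<^sub>,\<^sub>\<alpha> (- t powr \<alpha>)\<close>, with Laplace transform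
  \<open>1 / (s powr \<alpha> + 1)\<close>.\<close>

abbreviation resolvent :: "real \<Rightarrow> real \<Rightarrow> real" where
  "resolvent \<alpha> \<equiv> ml_kernel \<alpha> \<alpha> (geom 1)"

text \<open>The identity \<open>e + k * e = k\<close> for \<open>k = frac_power \<alpha>\<close>; in power series,
  \<open>geom 1 + X * geom 1 = 1\<close>.\<close>

lemma resolvent_volterra:
  assumes \<alpha>: "\<alpha> > 0" and t: "t \<ge> 0"
  shows "has_bochner_integral (lebesgue_on {0..t})
    (\<lambda>s. resolvent \<alpha> s * frac_power \<alpha> (t - s)) (frac_power \<alpha> t - resolvent \<alpha> t)"
proof -
  have "ml_kernel \<alpha> \<alpha> (geom 1 + fps_X * geom 1) t = frac_power \<alpha> t"
    using geom_recurrence[of 1] by (simp add: ml_kernel_one)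
  moreover have "ml_kernel \<alpha> \<alpha> (geom 1 + fps_X * geom 1) t =
      resolvent \<alpha> t + ml_kernel \<alpha> (\<alpha> + \<alpha>) (geom 1) t"
    using \<alpha> fps_conv_radius_geom[of 1]
    by (subst ml_kernel_X_mult[symmetric])
       (simp_all add: ml_kernel_def ml_transform_add fps_conv_radius_mult_pos algebra_simps)
  ultimately have "ml_kernel \<alpha> (\<alpha> + \<alpha>) (geom 1) t = frac_power \<alpha> t - resolvent \<alpha> t"
    by linarith
  then show ?thesis
    using ml_kernel_convolution[OF \<alpha> fps_conv_radius_geom[of 1] fps_conv_radius_one_pos \<alpha> \<alpha> t]
    by (simp only: ml_kernel_one mult_1_right)
qed

text \<open>Let \<open>e\<close> be the resolvent and \<open>k = frac_power \<alpha>\<close>, and suppose that \<open>e\<close> has a first zero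
  \<open>t0\<close>. For \<open>r < t0\<close> log-convexity of \<open>k\<close> gives \<open>k (t0 - s) \<le> \<rho> * k (r - s)\<close> on \<open>(0, r)\<close>
  with \<open>\<rho> = k t0 / k r\<close>. Inserting this into the Volterra equations at \<open>t0\<close> and at \<open>r\<close>
  shows that \<open>\<rho> * e r\<close> is at most the integral of \<open>k (t0 - s) * e s\<close> over \<open>[r, t0]\<close>. If
  \<open>r\<close> is chosen where \<open>e\<close> is maximal on a short interval \<open>[t0 - d, t0]\<close>, the right-hand
  side is at most \<open>e r\<close> times the integral of \<open>k\<close> over \<open>[0, d]\<close>, which is smaller than
  \<open>\<rho>\<close>: a contradiction.\<close>

theorem resolvent_pos:
  assumes \<alpha>: "0 < \<alpha>" "\<alpha> \<le> 1" and t: "t > 0"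
  shows "resolvent \<alpha> t > 0"
proof (rule ccontr)
  let ?E = "ml_transform \<alpha> \<alpha> (geom 1)" and ?e = "resolvent \<alpha>"
  assume "\<not> ?e t > 0"
  define Z where "Z = {x \<in> {0..}. ?E x \<le> 0}"
  have contE: "continuous_on S ?E" for S
    by (intro continuous_at_imp_continuous_on ballI isCont_ml_transform \<alpha> fps_conv_radius_geom)
  have "closed Z"
  proof -
    have "Z = {0..} \<inter> {x. ?E x \<le> 0}" by (auto simp: Z_def)
    then show ?thesis using contE by (auto intro!: closed_Int closed_Collect_le)
  qed
  moreover have "t powr \<alpha> \<in> Z"
    using \<open>\<not> ?e t > 0\<close> t by (auto simp: Z_def ml_kernel_def zero_less_mult_iff)
  moreover have "bdd_below Z" by (auto simp: Z_def)
  ultimately have x0: "Inf Z \<in> Z" and minimal: "\<And>x. x \<in> Z \<Longrightarrow> Inf Z \<le> x"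
    by (auto intro: closed_contains_Inf cInf_lower)
  define t0 where "t0 = Inf Z powr (1 / \<alpha>)"
  have "?E 0 > 0" using \<alpha> Gamma_real_pos[of \<alpha>] by (simp add: rGamma_inverse_Gamma)
  then have "Inf Z \<noteq> 0" using x0 by (auto simp: Z_def)
  then have "Inf Z > 0" using x0 by (auto simp: Z_def)
  then have t0: "t0 > 0" and t0_powr: "t0 powr \<alpha> = Inf Z"
    using \<alpha> by (auto simp: t0_def powr_powr)
  have e_t0: "?e t0 \<le> 0"
    using x0 by (auto simp: ml_kernel_def t0_powr Z_def mult_nonneg_nonpos)
  have e_pos: "?e s > 0" if s: "0 < s" "s < t0" for s
  proof -
    have "s powr \<alpha> < Inf Z"
      using s \<alpha> by (simp flip: t0_powr add: powr_less_mono2)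
    then have "s powr \<alpha> \<notin> Z" using minimal by force
    then have "?E (s powr \<alpha>) > 0" by (auto simp: Z_def)
    then show ?thesis using s by (simp add: ml_kernel_def)
  qed
  have rG: "rGamma \<alpha> > 0" using \<alpha> Gamma_real_pos[of \<alpha>] by (simp add: rGamma_inverse_Gamma)
  \<comment> \<open>The interval \<open>[t0 - d, t0]\<close> stays in the right half of \<open>(0, t0]\<close>, and \<open>k\<close> has integral at most 1/4 over \<open>[0, d]\<close>.\<close>
  define d where "d = min (t0 / 2) ((\<alpha> / (4 * rGamma \<alpha>)) powr (1 / \<alpha>))"
  have d: "d > 0" "d \<le> t0 / 2" using t0 \<alpha> rG by (auto simp: d_def)
  have "d powr \<alpha> \<le> ((\<alpha> / (4 * rGamma \<alpha>)) powr (1 / \<alpha>)) powr \<alpha>"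
    using d \<alpha> by (intro powr_mono2) (auto simp: d_def)
  then have d_small: "d powr \<alpha> / \<alpha> * rGamma \<alpha> \<le> 1 / 4"
    using \<alpha> rG by (simp add: powr_powr field_simps)
  have "continuous_on {t0 - d..t0} ?e"
    using d t0 by (intro continuous_on_subset[OF continuous_on_ml_kernel] \<alpha> fps_conv_radius_geom) auto
  then obtain r where r: "r \<in> {t0 - d..t0}" and r_max: "\<And>s. s \<in> {t0 - d..t0} \<Longrightarrow> ?e s \<le> ?e r"
    using continuous_attains_sup[of "{t0 - d..t0}" ?e] d by auto
  have "?e (t0 - d) > 0" using d t0 by (intro e_pos) auto
  then have e_r: "?e r > 0" using r_max[of "t0 - d"] d by auto
  then have r_less: "r < t0" using e_t0 r by (cases "r = t0") auto
  have r_pos: "r > 0" using r d t0 by auto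
  define \<rho> where "\<rho> = (t0 / r) powr (\<alpha> - 1)"
  have \<rho>: "\<rho> \<ge> 1 / 2"
  proof -
    have "t0 / r \<le> 2" using r d r_pos by (simp add: field_simps)
    then have "2 powr (\<alpha> - 1) \<le> \<rho>"
      unfolding \<rho>_def using \<alpha> t0 r_pos by (intro powr_mono2') auto
    moreover have "2 powr (-1) \<le> (2 :: real) powr (\<alpha> - 1)" using \<alpha> by (intro powr_mono) auto
    ultimately show ?thesis by (simp add: powr_minus)
  qed
  have \<rho>_k: "\<rho> * frac_power \<alpha> r = frac_power \<alpha> t0"
    using r_pos t0 by (simp add: \<rho>_def powr_divide)
  have int0: "((\<lambda>s. ?e s * frac_power \<alpha> (t0 - s)) has_integral (frac_power \<alpha> t0 - ?e t0)) {0..t0}"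
    using t0 \<alpha> by (intro has_integral_of_bochner resolvent_volterra) auto
  have intr: "((\<lambda>s. ?e s * frac_power \<alpha> (r - s)) has_integral (frac_power \<alpha> r - ?e r)) {0..r}"
    using r_pos \<alpha> by (intro has_integral_of_bochner resolvent_volterra) auto
  define I1 where "I1 = integral {0..r} (\<lambda>s. ?e s * frac_power \<alpha> (t0 - s))"
  define I2 where "I2 = integral {r..t0} (\<lambda>s. ?e s * frac_power \<alpha> (t0 - s))"
  have "(\<lambda>s. ?e s * frac_power \<alpha> (t0 - s)) integrable_on {0..t0}"
    using int0 by blast
  then have I1: "((\<lambda>s. ?e s * frac_power \<alpha> (t0 - s)) has_integral I1) {0..r}"
    and I2: "((\<lambda>s. ?e s * frac_power \<alpha> (t0 - s)) has_integral I2) {r..t0}"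
    unfolding I1_def I2_def using r_pos r_less
    by (auto intro!: integrable_integral elim: integrable_on_subinterval)
  have "((\<lambda>s. ?e s * frac_power \<alpha> (t0 - s)) has_integral (I1 + I2)) {0..t0}"
    using I1 I2 r_pos r_less by (intro has_integral_combine[where c = r]) auto
  then have sum_I: "I1 + I2 = frac_power \<alpha> t0 - ?e t0"
    using int0 has_integral_unique by blast
  \<comment> \<open>At the endpoint \<open>s = r\<close> the pointwise bound fails, as \<open>0 powr (\<alpha> - 1) = 0\<close>, so open intervals are compared.\<close>
  have "I1 \<le> \<rho> * (frac_power \<alpha> r - ?e r)"
  proof (rule has_integral_le)
    show "((\<lambda>s. ?e s * frac_power \<alpha> (t0 - s)) has_integral I1) {0<..<r}"
      using I1 by (simp add: has_integral_Icc_iff_Ioo)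
    show "((\<lambda>s. \<rho> * (?e s * frac_power \<alpha> (r - s))) has_integral \<rho> * (frac_power \<alpha> r - ?e r)) {0<..<r}"
      using has_integral_mult_right[OF intr, of \<rho>] by (simp only: has_integral_Icc_iff_Ioo)
    fix s assume s: "s \<in> {0<..<r}"
    have "t0 * s \<ge> r * s" using s r_less by simp
    then have "t0 / r * (r - s) \<le> t0 - s"
      using s r_pos by (simp add: field_simps)
    then have "(t0 - s) powr (\<alpha> - 1) \<le> (t0 / r * (r - s)) powr (\<alpha> - 1)"
      using \<alpha> s t0 r_pos by (intro powr_mono2') auto
    also have "\<dots> = \<rho> * (r - s) powr (\<alpha> - 1)"
      using s t0 r_pos powr_mult[of "t0 / r" "r - s" "\<alpha> - 1"] by (simp add: \<rho>_def)
    finally have "frac_power \<alpha> (t0 - s) \<le> \<rho> * frac_power \<alpha> (r - s)"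
      using rG by (simp flip: mult.assoc)
    moreover have "?e s \<ge> 0" using e_pos[of s] s r_less by auto
    ultimately have "?e s * frac_power \<alpha> (t0 - s) \<le> ?e s * (\<rho> * frac_power \<alpha> (r - s))"
      by (rule mult_left_mono)
    then show "?e s * frac_power \<alpha> (t0 - s) \<le> \<rho> * (?e s * frac_power \<alpha> (r - s))"
      by (subst mult.left_commute)
  qed
  moreover have "I2 \<le> ?e r * ((t0 - r) powr \<alpha> / \<alpha> * rGamma \<alpha>)"
  proof (rule has_integral_le[OF I2])
    show "((\<lambda>s. ?e r * frac_power \<alpha> (t0 - s)) has_integral ?e r * ((t0 - r) powr \<alpha> / \<alpha> * rGamma \<alpha>)) {r..t0}"
      using r_less \<alpha> by (intro has_integral_mult_right has_integral_mult_left has_integral_powr_reflected) auto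
    fix s assume "s \<in> {r..t0}"
    then have "?e s \<le> ?e r" using r by (intro r_max) auto
    then show "?e s * frac_power \<alpha> (t0 - s) \<le> ?e r * frac_power \<alpha> (t0 - s)"
      using \<alpha> by (intro mult_right_mono frac_power_nonneg)
  qed
  moreover have "(t0 - r) powr \<alpha> / \<alpha> * rGamma \<alpha> \<le> 1 / 4"
  proof -
    have "(t0 - r) powr \<alpha> \<le> d powr \<alpha>" using r r_less \<alpha> by (intro powr_mono2) auto
    then have "(t0 - r) powr \<alpha> / \<alpha> * rGamma \<alpha> \<le> d powr \<alpha> / \<alpha> * rGamma \<alpha>"
      using rG \<alpha> by (intro mult_right_mono divide_right_mono) auto
    with d_small show ?thesis by linarith
  qed
  then have "?e r * ((t0 - r) powr \<alpha> / \<alpha> * rGamma \<alpha>) \<le> ?e r * (1 / 4)"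
    using e_r by (intro mult_left_mono) auto
  moreover have "?e r * (1 / 2) \<le> \<rho> * ?e r"
    using \<rho> e_r by (simp add: field_simps)
  ultimately show False
    using sum_I e_t0 e_r unfolding right_diff_distrib \<rho>_k by linarith
qed

lemma resolvent_nonneg:
  assumes "0 < \<alpha>" "\<alpha> \<le> 1" "t \<ge> 0"
  shows "resolvent \<alpha> t \<ge> 0"
  using resolvent_pos[of \<alpha> t] assms by (cases "t = 0") (auto simp: ml_kernel_def less_imp_le)

section \<open>Boundedness on the negative axis\<close>

text \<open>Multiplication by \<open>X / (1 + X)\<close> is convolution with the resolvent.\<close>

lemma ml_kernel_resolvent_convolution:
  assumes \<alpha>: "\<alpha> > 0" and B: "fps_conv_radius B > 0" and t: "t \<ge> 0"
  shows "((\<lambda>s. resolvent \<alpha> s * ml_kernel \<alpha> 1 B (t - s)) has_integral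
    ml_kernel \<alpha> 1 (fps_X * geom 1 * B) t) {0..t}"
proof -
  have "ml_kernel \<alpha> (\<alpha> + 1) (geom 1 * B) t = ml_kernel \<alpha> 1 (fps_X * (geom 1 * B)) t"
    using \<alpha> B by (subst ml_kernel_X_mult)
      (auto intro: fps_conv_radius_mult_pos fps_conv_radius_geom simp: add.commute)
  then show ?thesis
    using has_integral_of_bochner[OF ml_kernel_convolution[OF \<alpha> fps_conv_radius_geom[of 1] B \<alpha> zero_less_one t]]
    by (simp add: mult.assoc)
qed

text \<open>The left-hand side is the integral of the resolvent \<open>e\<close> over \<open>[0, t]\<close>. Since
  \<open>k = frac_power \<alpha>\<close> decreases, \<open>k t\<close> times this integral is at most
  \<open>(k * e) t = k t - e t\<close>.\<close>

lemma integral_resolvent_le_1: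
  assumes \<alpha>: "0 < \<alpha>" "\<alpha> \<le> 1" and t: "t > 0"
  shows "ml_kernel \<alpha> 1 (fps_X * geom 1) t \<le> 1"
proof -
  have rG: "rGamma \<alpha> > 0" using \<alpha> Gamma_real_pos[of \<alpha>] by (simp add: rGamma_inverse_Gamma)
  have "((\<lambda>s. resolvent \<alpha> s * ml_kernel \<alpha> 1 1 (t - s)) has_integral
      ml_kernel \<alpha> 1 (fps_X * geom 1 * 1) t) {0..t}"
    using \<alpha> t by (intro ml_kernel_resolvent_convolution) auto
  then have int1: "((\<lambda>s. resolvent \<alpha> s * frac_power 1 (t - s)) has_integral
      ml_kernel \<alpha> 1 (fps_X * geom 1) t) {0<..<t}"
    by (simp add: ml_kernel_one has_integral_Icc_iff_Ioo)
  have "((\<lambda>s. resolvent \<alpha> s * frac_power \<alpha> (t - s)) has_integral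
      (frac_power \<alpha> t - resolvent \<alpha> t)) {0..t}"
    using \<alpha> t by (intro has_integral_of_bochner resolvent_volterra) auto
  then have int2: "((\<lambda>s. resolvent \<alpha> s * frac_power \<alpha> (t - s)) has_integral
      (frac_power \<alpha> t - resolvent \<alpha> t)) {0<..<t}"
    by (simp only: has_integral_Icc_iff_Ioo)
  have "frac_power \<alpha> t * ml_kernel \<alpha> 1 (fps_X * geom 1) t \<le> frac_power \<alpha> t - resolvent \<alpha> t"
  proof (rule has_integral_le[OF has_integral_mult_right[OF int1] int2])
    fix s assume s: "s \<in> {0<..<t}"
    have "t powr (\<alpha> - 1) \<le> (t - s) powr (\<alpha> - 1)"
      using s \<alpha> by (intro powr_mono2') auto
    then have "frac_power \<alpha> t \<le> frac_power \<alpha> (t - s)"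
      using rG by (intro mult_right_mono) auto
    then have "resolvent \<alpha> s * frac_power \<alpha> t \<le> resolvent \<alpha> s * frac_power \<alpha> (t - s)"
      using s \<alpha> by (intro mult_left_mono resolvent_nonneg) auto
    moreover have "frac_power 1 (t - s) = 1" using s by simp
    ultimately show "frac_power \<alpha> t * (resolvent \<alpha> s * frac_power 1 (t - s))
        \<le> resolvent \<alpha> s * frac_power \<alpha> (t - s)"
      by (simp only: mult_1_right mult.commute[of "frac_power \<alpha> t"])
  qed
  also have "\<dots> \<le> frac_power \<alpha> t * 1"
    using resolvent_nonneg[OF \<alpha>, of t] t by simp
  finally show ?thesis
    using rG t by (simp add: zero_less_mult_iff)
qed

lemma fps_conv_radius_power_geom: "fps_conv_radius ((fps_X * geom 1) ^ k) > 0"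
  by (induction k) (simp_all add: fps_conv_radius_mult_pos fps_conv_radius_geom)

text \<open>By induction on \<open>k\<close>, as convolution with a positive function of mass at most 1 preserves
  the bounds. The upper bound is the function 1, except that it is 0 at \<open>t = 0\<close> since
  \<open>0 powr 0 = 0\<close>.\<close>

lemma ml_kernel_power_bounds:
  assumes \<alpha>: "0 < \<alpha>" "\<alpha> \<le> 1" and t: "t \<ge> 0"
  shows "0 \<le> ml_kernel \<alpha> 1 ((fps_X * geom 1) ^ k) t"
    and "ml_kernel \<alpha> 1 ((fps_X * geom 1) ^ k) t \<le> ml_kernel \<alpha> 1 1 t"
proof -
  have "0 \<le> ml_kernel \<alpha> 1 ((fps_X * geom 1) ^ k) t \<and>
    ml_kernel \<alpha> 1 ((fps_X * geom 1) ^ k) t \<le> ml_kernel \<alpha> 1 1 t"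
    using t
  proof (induction k arbitrary: t)
    case 0
    then show ?case by (simp add: ml_kernel_one)
  next
    case (Suc k)
    note int = ml_kernel_resolvent_convolution[OF \<alpha>(1) fps_conv_radius_power_geom Suc.prems]
    note int1 = ml_kernel_resolvent_convolution[OF \<alpha>(1) fps_conv_radius_one_pos Suc.prems]
    have nonneg: "0 \<le> ml_kernel \<alpha> 1 ((fps_X * geom 1) ^ Suc k) t"
      unfolding power_Suc using int
    proof (rule has_integral_nonneg)
      fix s assume "s \<in> {0..t}"
      then show "0 \<le> resolvent \<alpha> s * ml_kernel \<alpha> 1 ((fps_X * geom 1) ^ k) (t - s)"
        using \<alpha> Suc.IH[of "t - s"] by (intro mult_nonneg_nonneg resolvent_nonneg) auto
    qed
    have "ml_kernel \<alpha> 1 ((fps_X * geom 1) ^ Suc k) t \<le> ml_kernel \<alpha> 1 (fps_X * geom 1 * 1) t"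
      unfolding power_Suc using int int1
    proof (rule has_integral_le)
      fix s assume "s \<in> {0..t}"
      then show "resolvent \<alpha> s * ml_kernel \<alpha> 1 ((fps_X * geom 1) ^ k) (t - s)
          \<le> resolvent \<alpha> s * ml_kernel \<alpha> 1 1 (t - s)"
        using \<alpha> Suc.IH[of "t - s"] by (intro mult_left_mono resolvent_nonneg) auto
    qed
    also have "\<dots> \<le> ml_kernel \<alpha> 1 1 t"
    proof (cases "t = 0")
      case True
      then show ?thesis by (simp add: ml_kernel_def)
    next
      case False
      then show ?thesis
        using integral_resolvent_le_1[OF \<alpha>, of t] Suc.prems by (simp add: ml_kernel_one)
    qed
    finally show ?case using nonneg by simp
  qed
  then show "0 \<le> ml_kernel \<alpha> 1 ((fps_X * geom 1) ^ k) t"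
    "ml_kernel \<alpha> 1 ((fps_X * geom 1) ^ k) t \<le> ml_kernel \<alpha> 1 1 t" by auto
qed

lemma fps_XD_mult: "fps_XD (A * B) = fps_XD A * B + A * fps_XD (B :: 'a :: comm_ring_1 fps)"
  by (simp add: fps_XD_def algebra_simps)

lemma fps_XD_geom: "fps_XD (geom c) = - (fps_const c * fps_X * geom c * geom c)"
proof -
  have "fps_XD (geom c + fps_const c * (fps_X * geom c)) = 0"
    unfolding geom_recurrence by (simp add: fps_XD_def)
  then have "(fps_XD (geom c) + fps_const c * fps_X * fps_XD (geom c)) + fps_const c * fps_X * geom c = 0"
    by (simp add: fps_XD_def algebra_simps)
  then have *: "fps_XD (geom c) + fps_const c * fps_X * fps_XD (geom c) = - (fps_const c * fps_X * geom c)"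
    by (simp only: eq_neg_iff_add_eq_0)
  have "(geom c + fps_const c * (fps_X * geom c)) * fps_XD (geom c) =
      geom c * (fps_XD (geom c) + fps_const c * fps_X * fps_XD (geom c))"
    by (simp only: ring_distribs ac_simps)
  also have "\<dots> = - (fps_const c * fps_X * geom c * geom c)"
    unfolding * by (simp only: mult_minus_right ac_simps)
  finally have "(geom c + fps_const c * (fps_X * geom c)) * fps_XD (geom c) =
      - (fps_const c * fps_X * geom c * geom c)" .
  then show ?thesis unfolding geom_recurrence by simp
qed

text \<open>With \<open>w = X / (1 + X)\<close> one has \<open>X dw/dX = w (1 - w)\<close>. Hence the span of the powers of
  \<open>w\<close> is invariant under the Euler operator.\<close>

lemma fps_XD_power_geom:
  "fps_XD ((fps_X * geom 1) ^ k) =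
    fps_const (real k) * ((fps_X * geom 1) ^ k + fps_const (-1) * (fps_X * geom 1) ^ Suc k)"
proof (induction k)
  case (Suc k)
  define w where "w = fps_X * geom 1"
  have g: "geom 1 = 1 - w"
    using geom_recurrence[of 1] by (simp add: w_def algebra_simps)
  have w': "fps_XD w = w * (1 - w)"
  proof -
    have "fps_XD w = w + fps_X * fps_XD (geom 1)"
      by (simp add: w_def fps_XD_mult) (simp add: fps_XD_def)
    also have "fps_X * fps_XD (geom 1) = - (w * w)"
      by (simp add: fps_XD_geom w_def algebra_simps)
    finally show ?thesis by (simp add: algebra_simps)
  qed
  have "fps_XD (w ^ Suc k) = fps_XD w * w ^ k + w * fps_XD (w ^ k)"
    by (simp add: fps_XD_mult)
  also have "fps_XD (w ^ k) = fps_const (real k) * (w ^ k + fps_const (-1) * w ^ Suc k)"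
    using Suc.IH by (simp add: w_def)
  finally show ?case
    unfolding w' w_def [symmetric] by (simp add: algebra_simps flip: fps_const_add fps_const_neg)
qed (simp add: fps_XD_def)

text \<open>The kernel with parameter \<open>\<delta>\<close> is the fractional integral of order \<open>\<delta> - 1\<close> of the kernel
  with parameter 1, which takes values in \<open>[0, 1]\<close>.\<close>

lemma ml_transform_power_bounded_of_gt_1:
  assumes \<alpha>: "0 < \<alpha>" "\<alpha> \<le> 1" and \<delta>: "\<delta> > 1" and x: "x > 0"
  shows "\<bar>ml_transform \<alpha> \<delta> ((fps_X * geom 1) ^ k) x\<bar> \<le> rGamma \<delta>"
proof -
  define t where "t = x powr (1 / \<alpha>)"
  have t: "t > 0" "t powr \<alpha> = x" using x \<alpha> by (auto simp: t_def powr_powr)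
  let ?w = "(fps_X * geom 1) ^ k :: real fps"
  have "has_bochner_integral (lebesgue_on {0..t})
      (\<lambda>s. ml_kernel \<alpha> (\<delta> - 1) 1 s * ml_kernel \<alpha> 1 ?w (t - s)) (ml_kernel \<alpha> ((\<delta> - 1) + 1) (1 * ?w) t)"
    using \<alpha> \<delta> t fps_conv_radius_power_geom by (intro ml_kernel_convolution) auto
  from has_integral_of_bochner[OF this]
  have int: "((\<lambda>s. ml_kernel \<alpha> (\<delta> - 1) 1 s * ml_kernel \<alpha> 1 ?w (t - s)) has_integral ml_kernel \<alpha> \<delta> ?w t) {0..t}"
    by simp
  have "has_bochner_integral (lebesgue_on {0..t})
      (\<lambda>s. ml_kernel \<alpha> (\<delta> - 1) 1 s * ml_kernel \<alpha> 1 1 (t - s)) (ml_kernel \<alpha> ((\<delta> - 1) + 1) (1 * 1) t)"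
    using \<alpha> \<delta> t by (intro ml_kernel_convolution) auto
  from has_integral_of_bochner[OF this]
  have int1: "((\<lambda>s. ml_kernel \<alpha> (\<delta> - 1) 1 s * ml_kernel \<alpha> 1 1 (t - s)) has_integral frac_power \<delta> t) {0..t}"
    by (simp add: ml_kernel_one)
  have nonneg: "0 \<le> ml_kernel \<alpha> (\<delta> - 1) 1 s" for s
    using \<delta> frac_power_nonneg[of "\<delta> - 1" s] by (simp add: ml_kernel_one)
  have "0 \<le> ml_kernel \<alpha> \<delta> ?w t"
    using int
  proof (rule has_integral_nonneg)
    fix s assume "s \<in> {0..t}"
    then show "0 \<le> ml_kernel \<alpha> (\<delta> - 1) 1 s * ml_kernel \<alpha> 1 ?w (t - s)"
      using \<alpha> by (intro mult_nonneg_nonneg nonneg ml_kernel_power_bounds) auto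
  qed
  moreover have "ml_kernel \<alpha> \<delta> ?w t \<le> frac_power \<delta> t"
    using int int1
  proof (rule has_integral_le)
    fix s assume "s \<in> {0..t}"
    then show "ml_kernel \<alpha> (\<delta> - 1) 1 s * ml_kernel \<alpha> 1 ?w (t - s)
        \<le> ml_kernel \<alpha> (\<delta> - 1) 1 s * ml_kernel \<alpha> 1 1 (t - s)"
      using \<alpha> by (intro mult_left_mono nonneg ml_kernel_power_bounds) auto
  qed
  ultimately show ?thesis
    using t by (simp add: ml_kernel_def zero_le_mult_iff)
qed

text \<open>The step from \<open>\<gamma>\<close> to \<open>\<gamma> - 1\<close> expresses the transform of \<open>w ^ k\<close> by those of \<open>w ^ k\<close> and
  \<open>w ^ (k + 1)\<close>, so the induction needs all powers at once.\<close>

lemma ml_transform_power_bounded: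
  assumes \<alpha>: "0 < \<alpha>" "\<alpha> \<le> 1" and \<delta>: "\<delta> > 1"
  shows "\<exists>M. \<forall>x>0. \<bar>ml_transform \<alpha> (\<delta> - real n) ((fps_X * geom 1) ^ k) x\<bar> \<le> M"
proof (induction n arbitrary: k)
  case 0
  then show ?case using ml_transform_power_bounded_of_gt_1[OF \<alpha> \<delta>] by auto
next
  case (Suc n)
  let ?\<gamma> = "\<delta> - real n" and ?w = "\<lambda>k. (fps_X * geom 1) ^ k :: real fps"
  obtain M1 where M1: "\<And>x. x > 0 \<Longrightarrow> \<bar>ml_transform \<alpha> ?\<gamma> (?w k) x\<bar> \<le> M1"
    using Suc.IH by blast
  obtain M2 where M2: "\<And>x. x > 0 \<Longrightarrow> \<bar>ml_transform \<alpha> ?\<gamma> (?w (Suc k)) x\<bar> \<le> M2"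
    using Suc.IH by blast
  have rec: "ml_transform \<alpha> (?\<gamma> - 1) (?w k) x =
      (\<alpha> * real k + ?\<gamma> - 1) * ml_transform \<alpha> ?\<gamma> (?w k) x
      - \<alpha> * real k * ml_transform \<alpha> ?\<gamma> (?w (Suc k)) x" for x
  proof -
    have r: "fps_conv_radius (fps_const (-1) * ?w (Suc k)) > 0"
      "fps_conv_radius (?w k + fps_const (-1) * ?w (Suc k)) > 0"
      using fps_conv_radius_power_geom[of k] fps_conv_radius_power_geom[of "Suc k"]
        fps_conv_radius_add[of "?w k" "fps_const (-1) * ?w (Suc k)"]
      by (auto simp: fps_conv_radius_cmult_left min_def simp del: power_Suc split: if_splits)
    have "ml_transform \<alpha> (?\<gamma> - 1) (?w k) x =
       ml_transform \<alpha> ?\<gamma> (fps_const (\<alpha> * real k) * (?w k + fps_const (-1) * ?w (Suc k))) x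
       + (?\<gamma> - 1) * ml_transform \<alpha> ?\<gamma> (?w k) x"
      unfolding ml_transform_lower[OF \<alpha>(1) fps_conv_radius_power_geom] fps_XD_power_geom
      by (simp only: fps_const_mult [symmetric] mult.assoc)
    also have "ml_transform \<alpha> ?\<gamma> (fps_const (\<alpha> * real k) * (?w k + fps_const (-1) * ?w (Suc k))) x =
       \<alpha> * real k * (ml_transform \<alpha> ?\<gamma> (?w k) x - ml_transform \<alpha> ?\<gamma> (?w (Suc k)) x)"
      by (simp only: ml_transform_cmult[OF \<alpha>(1) r(2)]
        ml_transform_add[OF \<alpha>(1) fps_conv_radius_power_geom r(1)]
        ml_transform_cmult[OF \<alpha>(1) fps_conv_radius_power_geom]) simp
    finally show ?thesis by (simp only: ring_distribs)
  qed
  have "\<bar>ml_transform \<alpha> (?\<gamma> - 1) (?w k) x\<bar> \<le>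
     \<bar>\<alpha> * real k + ?\<gamma> - 1\<bar> * M1 + \<bar>\<alpha> * real k\<bar> * M2" if x: "x > 0" for x
  proof -
    have "\<bar>ml_transform \<alpha> (?\<gamma> - 1) (?w k) x\<bar> \<le>
      \<bar>\<alpha> * real k + ?\<gamma> - 1\<bar> * \<bar>ml_transform \<alpha> ?\<gamma> (?w k) x\<bar>
      + \<bar>\<alpha> * real k\<bar> * \<bar>ml_transform \<alpha> ?\<gamma> (?w (Suc k)) x\<bar>"
      unfolding rec abs_mult [symmetric] by (rule abs_triangle_ineq4)
    also have "\<dots> \<le> \<bar>\<alpha> * real k + ?\<gamma> - 1\<bar> * M1 + \<bar>\<alpha> * real k\<bar> * M2"
      by (intro add_mono mult_left_mono M1 M2 x) auto
    finally show ?thesis .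
  qed
  then show ?case by (auto simp: algebra_simps)
qed

text \<open>Write \<open>1 / (1 + X) = 1 - w\<close> and start the descent above 1.\<close>

proposition mittag_leffler_bounded:
  assumes \<alpha>: "0 < \<alpha>" "\<alpha> \<le> 1"
  obtains M where "\<And>x. x > 0 \<Longrightarrow> \<bar>mittag_leffler \<alpha> \<gamma> (- x)\<bar> \<le> M"
proof -
  obtain n :: nat where "real n > 1 - \<gamma>" using reals_Archimedean2 by blast
  then have n: "\<gamma> + real n > 1" by simp
  obtain M where M: "\<And>x. x > 0 \<Longrightarrow> \<bar>ml_transform \<alpha> \<gamma> ((fps_X * geom 1) ^ 0) x\<bar> \<le> M"
    using ml_transform_power_bounded[OF \<alpha> n, of n 0] by auto
  obtain M' where M': "\<And>x. x > 0 \<Longrightarrow> \<bar>ml_transform \<alpha> \<gamma> ((fps_X * geom 1) ^ 1) x\<bar> \<le> M'"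
    using ml_transform_power_bounded[OF \<alpha> n, of n 1] by auto
  show ?thesis
  proof (rule that)
    fix x :: real assume x: "x > 0"
    have "ml_transform \<alpha> \<gamma> 1 x = ml_transform \<alpha> \<gamma> (geom 1) x + ml_transform \<alpha> \<gamma> (fps_X * geom 1) x"
      using ml_transform_add[OF \<alpha>(1) fps_conv_radius_geom[of 1] fps_conv_radius_power_geom[of 1], of \<gamma> x]
        geom_recurrence[of 1] by simp
    then show "\<bar>mittag_leffler \<alpha> \<gamma> (- x)\<bar> \<le> M + M'"
      using M[OF x] M'[OF x] mittag_leffler_conv_transform[of \<alpha> \<gamma> 1 x] by simp
  qed
qed

section \<open>Decay at infinity\<close>

lemma mittag_leffler_recurrence:
  assumes \<alpha>: "\<alpha> > 0"
  shows "y * mittag_leffler \<alpha> (\<gamma> + \<alpha>) (- y) = rGamma \<gamma> - mittag_leffler \<alpha> \<gamma> (- y)"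
proof -
  have "ml_transform \<alpha> \<gamma> (geom 1 + fps_X * geom 1) y = rGamma \<gamma>"
    using geom_recurrence[of 1] ml_transform_const[of \<alpha> \<gamma> 1 y] by simp
  moreover have "ml_transform \<alpha> \<gamma> (geom 1 + fps_X * geom 1) y =
      ml_transform \<alpha> \<gamma> (geom 1) y + y * ml_transform \<alpha> (\<gamma> + \<alpha>) (geom 1) y"
    using \<alpha> by (simp add: ml_transform_add ml_transform_X_mult fps_conv_radius_mult_pos fps_conv_radius_geom)
  ultimately show ?thesis
    using mittag_leffler_conv_transform[of \<alpha> _ 1 y] by simp
qed

lemma bigo_mult_powr:
  assumes "f \<in> O[at_top](\<lambda>t. t powr a)"
  shows "(\<lambda>t. f t * t powr b) \<in> O[at_top](\<lambda>t :: real. t powr (a + b))"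
proof -
  have "(\<lambda>t. t powr b) \<in> O[at_top](\<lambda>t. t powr b)" by simp
  from landau_o.big.mult[OF assms this] show ?thesis by (simp add: powr_add)
qed

lemma bigo_cmult:
  fixes f g :: "real \<Rightarrow> real"
  shows "f \<in> O[F](g) \<Longrightarrow> (\<lambda>t. c * f t) \<in> O[F](g)"
  by (cases "c = 0") auto

lemma mittag_leffler_bigo_1:
  assumes \<alpha>: "0 < \<alpha>" "\<alpha> \<le> 1" and c: "c > 0"
  shows "(\<lambda>t. mittag_leffler \<alpha> \<gamma> (- c * t powr \<alpha>)) \<in> O[at_top](\<lambda>t. t powr 0)"
proof -
  obtain M where M: "\<And>x. x > 0 \<Longrightarrow> \<bar>mittag_leffler \<alpha> \<gamma> (- x)\<bar> \<le> M"
    using mittag_leffler_bounded[OF \<alpha>] by blast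
  show ?thesis
  proof (rule bigoI)
    show "\<forall>\<^sub>F t in at_top. norm (mittag_leffler \<alpha> \<gamma> (- c * t powr \<alpha>)) \<le> M * norm (t powr 0)"
      using eventually_gt_at_top[of 0]
      by eventually_elim (use M c in simp)
  qed
qed

lemma mittag_leffler_bigo_step:
  assumes \<alpha>: "0 < \<alpha>" and c: "c > 0"
    and "(\<lambda>t. rGamma \<gamma> - mittag_leffler \<alpha> \<gamma> (- c * t powr \<alpha>)) \<in> O[at_top](\<lambda>t. t powr a)"
  shows "(\<lambda>t. mittag_leffler \<alpha> (\<gamma> + \<alpha>) (- c * t powr \<alpha>)) \<in> O[at_top](\<lambda>t. t powr (a - \<alpha>))"
proof -
  have "(\<lambda>t. inverse c * ((rGamma \<gamma> - mittag_leffler \<alpha> \<gamma> (- c * t powr \<alpha>)) * t powr (- \<alpha>)))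
      \<in> O[at_top](\<lambda>t. t powr (a + - \<alpha>))"
    using c bigo_mult_powr[OF assms(3), of "- \<alpha>"] by simp
  moreover have "\<forall>\<^sub>F t in at_top. mittag_leffler \<alpha> (\<gamma> + \<alpha>) (- c * t powr \<alpha>) =
      inverse c * ((rGamma \<gamma> - mittag_leffler \<alpha> \<gamma> (- c * t powr \<alpha>)) * t powr (- \<alpha>))"
    using eventually_gt_at_top[of 0]
  proof eventually_elim
    case (elim t)
    then show ?case
      using c mittag_leffler_recurrence[OF \<alpha>, of "c * t powr \<alpha>" \<gamma>]
      by (simp add: powr_minus field_simps)
  qed
  ultimately show ?thesis
    by (simp add: landau_o.big.in_cong)
qed

lemma mittag_leffler_bigo_powr:
  assumes \<alpha>: "0 < \<alpha>" "\<alpha> \<le> 1" and c: "c > 0"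
  shows "(\<lambda>t. mittag_leffler \<alpha> \<gamma> (- c * t powr \<alpha>)) \<in> O[at_top](\<lambda>t. t powr (- \<alpha>))"
proof -
  have "(\<lambda>t. rGamma (\<gamma> - \<alpha>)) \<in> O[at_top](\<lambda>t :: real. t powr 0)"
  proof (rule bigoI)
    show "\<forall>\<^sub>F t in at_top. norm (rGamma (\<gamma> - \<alpha>)) \<le> \<bar>rGamma (\<gamma> - \<alpha>)\<bar> * norm ((t :: real) powr 0)"
      using eventually_gt_at_top[of 0] by eventually_elim simp
  qed
  then have "(\<lambda>t. rGamma (\<gamma> - \<alpha>) - mittag_leffler \<alpha> (\<gamma> - \<alpha>) (- c * t powr \<alpha>))
      \<in> O[at_top](\<lambda>t. t powr 0)"
    by (intro sum_in_bigo mittag_leffler_bigo_1 \<alpha> c)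
  from mittag_leffler_bigo_step[OF \<alpha>(1) c this] show ?thesis by simp
qed

text \<open>If \<open>\<gamma> - \<alpha>\<close> is a pole of \<open>\<Gamma>\<close>, then the leading term \<open>1 / (\<Gamma> (\<gamma> - \<alpha>) * y)\<close> of the
  expansion of \<open>E\<^sub>\<alpha>\<^sub>,\<^sub>\<gamma> (-y)\<close> in powers of \<open>1 / y\<close> is absent.\<close>

lemma mittag_leffler_bigo_powr_pole:
  assumes \<alpha>: "0 < \<alpha>" "\<alpha> \<le> 1" and c: "c > 0" and pole: "rGamma (\<gamma> - \<alpha>) = 0"
  shows "(\<lambda>t. mittag_leffler \<alpha> \<gamma> (- c * t powr \<alpha>)) \<in> O[at_top](\<lambda>t. t powr (- 2 * \<alpha>))"
proof -
  have "(\<lambda>t. rGamma (\<gamma> - \<alpha>) - mittag_leffler \<alpha> (\<gamma> - \<alpha>) (- c * t powr \<alpha>))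
      \<in> O[at_top](\<lambda>t. t powr (- \<alpha>))"
    using mittag_leffler_bigo_powr[OF \<alpha> c] by (simp add: pole)
  moreover have "- \<alpha> - \<alpha> = - 2 * \<alpha>" by simp
  ultimately show ?thesis
    using mittag_leffler_bigo_step[OF \<alpha>(1) c, of "\<gamma> - \<alpha>" "- \<alpha>"] by (simp only: diff_add_cancel)
qed

section \<open>Response of a single mode\<close>

text \<open>The amplitude of an eigenfunction with eigenvalue \<open>\<mu>\<close> under the source
  \<open>t powr (\<beta> - 1) * E\<^sub>\<alpha>\<^sub>,\<^sub>\<beta> (- \<kappa> * t powr \<alpha>)\<close>.\<close>

definition modal_response :: "real \<Rightarrow> real \<Rightarrow> real \<Rightarrow> real \<Rightarrow> real \<Rightarrow> real" where
  "modal_response \<alpha> \<beta> \<kappa> \<mu> t = ml_kernel \<alpha> (\<alpha> + \<beta>) (geom \<mu> * geom \<kappa>) t"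

lemma geom_mult_partial_fractions:
  "fps_const (\<kappa> - \<mu>) * (geom \<mu> * geom \<kappa>) = fps_const \<kappa> * geom \<kappa> + fps_const (- \<mu>) * geom \<mu>"
proof -
  have "fps_const \<kappa> * geom \<kappa> + fps_const (- \<mu>) * geom \<mu> =
     fps_const \<kappa> * geom \<kappa> * (geom \<mu> + fps_const \<mu> * (fps_X * geom \<mu>))
     + fps_const (- \<mu>) * geom \<mu> * (geom \<kappa> + fps_const \<kappa> * (fps_X * geom \<kappa>))"
    by (simp only: geom_recurrence mult_1_right)
  also have "\<dots> = fps_const (\<kappa> - \<mu>) * (geom \<mu> * geom \<kappa>)"
    by (simp add: algebra_simps flip: fps_const_neg fps_const_sub)
  finally show ?thesis ..
qed

lemma geom_square: "geom \<mu> * geom \<mu> = fps_XD (geom \<mu>) + geom \<mu>"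
proof -
  have "geom \<mu> = geom \<mu> * (geom \<mu> + fps_const \<mu> * (fps_X * geom \<mu>))"
    by (simp only: geom_recurrence mult_1_right)
  then have "geom \<mu> = geom \<mu> * geom \<mu> + fps_const \<mu> * fps_X * geom \<mu> * geom \<mu>"
    by (simp only: ring_distribs ac_simps)
  then have "geom \<mu> * geom \<mu> = geom \<mu> - fps_const \<mu> * fps_X * geom \<mu> * geom \<mu>"
    by (subst eq_diff_eq) (rule sym)
  then show ?thesis by (simp add: fps_XD_geom)
qed

lemma modal_response_nonresonant:
  assumes \<alpha>: "\<alpha> > 0" and "\<kappa> \<noteq> \<mu>"
  shows "modal_response \<alpha> \<beta> \<kappa> \<mu> t =
    (\<kappa> * mittag_leffler \<alpha> (\<alpha> + \<beta>) (- \<kappa> * t powr \<alpha>) - \<mu> * mittag_leffler \<alpha> (\<alpha> + \<beta>) (- \<mu> * t powr \<alpha>))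
      / (\<kappa> - \<mu>) * t powr (\<alpha> + \<beta> - 1)"
proof -
  have r: "fps_conv_radius (fps_const c * geom d) > 0" for c d
    by (intro fps_conv_radius_mult_pos fps_conv_radius_geom) simp
  have "(\<kappa> - \<mu>) * ml_transform \<alpha> (\<alpha> + \<beta>) (geom \<mu> * geom \<kappa>) x =
      \<kappa> * ml_transform \<alpha> (\<alpha> + \<beta>) (geom \<kappa>) x - \<mu> * ml_transform \<alpha> (\<alpha> + \<beta>) (geom \<mu>) x" for x
  proof -
    have "(\<kappa> - \<mu>) * ml_transform \<alpha> (\<alpha> + \<beta>) (geom \<mu> * geom \<kappa>) x =
        ml_transform \<alpha> (\<alpha> + \<beta>) (fps_const (\<kappa> - \<mu>) * (geom \<mu> * geom \<kappa>)) x"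
      by (intro ml_transform_cmult [symmetric] \<alpha> fps_conv_radius_mult_pos fps_conv_radius_geom)
    then show ?thesis
      unfolding geom_mult_partial_fractions
      by (simp add: ml_transform_add[OF \<alpha> r r] ml_transform_cmult[OF \<alpha> fps_conv_radius_geom] del: fps_const_neg)
  qed
  then have "ml_transform \<alpha> (\<alpha> + \<beta>) (geom \<mu> * geom \<kappa>) x =
      (\<kappa> * ml_transform \<alpha> (\<alpha> + \<beta>) (geom \<kappa>) x - \<mu> * ml_transform \<alpha> (\<alpha> + \<beta>) (geom \<mu>) x) / (\<kappa> - \<mu>)" for x
    using assms(2) by (simp only: nonzero_eq_divide_eq[of "\<kappa> - \<mu>"] right_minus_eq mult.commute not_False_eq_True)
  then show ?thesis
    unfolding mittag_leffler_conv_transform modal_response_def ml_kernel_def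
    by (simp only: mult.commute)
qed

lemma modal_response_resonant:
  assumes \<alpha>: "\<alpha> > 0"
  shows "modal_response \<alpha> \<beta> \<mu> \<mu> t =
    1 / \<alpha> * (mittag_leffler \<alpha> (\<alpha> + \<beta> - 1) (- \<mu> * t powr \<alpha>)
      + (1 - \<beta>) * mittag_leffler \<alpha> (\<alpha> + \<beta>) (- \<mu> * t powr \<alpha>)) * t powr (\<alpha> + \<beta> - 1)"
proof -
  have r: "fps_conv_radius (fps_XD (geom \<mu>)) > 0"
    using fps_conv_radius_deriv[of "geom \<mu>"] fps_conv_radius_geom[of \<mu>]
    unfolding fps_XD_def o_def by (intro fps_conv_radius_mult_pos) auto
  have "ml_transform \<alpha> (\<alpha> + \<beta> - 1) (geom \<mu>) x + (1 - \<beta>) * ml_transform \<alpha> (\<alpha> + \<beta>) (geom \<mu>) x =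
      \<alpha> * ml_transform \<alpha> (\<alpha> + \<beta>) (geom \<mu> * geom \<mu>) x" for x
    unfolding geom_square
    by (simp add: ml_transform_lower ml_transform_cmult ml_transform_add \<alpha> r fps_conv_radius_geom algebra_simps)
  then show ?thesis
    using \<alpha> unfolding mittag_leffler_conv_transform modal_response_def ml_kernel_def
    by (simp add: field_simps)
qed

text \<open>In both formulas the constant terms of the recurrence cancel: they are equal for
  \<open>\<kappa> \<noteq> \<mu>\<close>, and for \<open>\<kappa> = \<mu>\<close> one has \<open>1 / \<Gamma> (\<beta> - 1) + (1 - \<beta>) / \<Gamma> \<beta> = 0\<close>. What is left is
  \<open>t powr (\<beta> - 1)\<close> times a combination of Mittag-Leffler functions with second parameters
  \<open>\<beta>\<close> and \<open>\<beta> - 1\<close>, so the decay rate of these is kept as a parameter \<open>a\<close>.\<close>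

lemma modal_response_bigo:
  assumes \<alpha>: "0 < \<alpha>" "\<alpha> \<le> 1" and \<kappa>: "\<kappa> > 0" and \<mu>: "\<mu> > 0"
    and E: "\<And>c. c > 0 \<Longrightarrow> (\<lambda>t. mittag_leffler \<alpha> \<beta> (- c * t powr \<alpha>)) \<in> O[at_top](\<lambda>t. t powr a)"
    and E': "\<And>c. c > 0 \<Longrightarrow> (\<lambda>t. mittag_leffler \<alpha> (\<beta> - 1) (- c * t powr \<alpha>)) \<in> O[at_top](\<lambda>t. t powr a)"
  shows "modal_response \<alpha> \<beta> \<kappa> \<mu> \<in> O[at_top](\<lambda>t. t powr (a + \<beta> - 1))"
proof -
  \<comment> \<open>The amplitude is \<open>h t * t powr (\<beta> - 1)\<close> for \<open>t > 0\<close>.\<close>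
  define h where "h = (if \<kappa> = \<mu> then
      (\<lambda>t. - 1 / (\<alpha> * \<mu>) * (mittag_leffler \<alpha> (\<beta> - 1) (- \<mu> * t powr \<alpha>)
        + (1 - \<beta>) * mittag_leffler \<alpha> \<beta> (- \<mu> * t powr \<alpha>)))
    else (\<lambda>t. 1 / (\<kappa> - \<mu>) * (mittag_leffler \<alpha> \<beta> (- \<mu> * t powr \<alpha>) - mittag_leffler \<alpha> \<beta> (- \<kappa> * t powr \<alpha>))))"
  have "h \<in> O[at_top](\<lambda>t. t powr a)"
    unfolding h_def by (cases "\<kappa> = \<mu>") (simp_all only: simp_thms if_True if_False bigo_cmult sum_in_bigo E E' \<kappa> \<mu>)
  from bigo_mult_powr[OF this, of "\<beta> - 1"]
  have "(\<lambda>t. h t * t powr (\<beta> - 1)) \<in> O[at_top](\<lambda>t. t powr (a + \<beta> - 1))"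
    by (simp add: add_diff_eq)
  moreover have "\<forall>\<^sub>F t in at_top. modal_response \<alpha> \<beta> \<kappa> \<mu> t = h t * t powr (\<beta> - 1)"
    using eventually_gt_at_top[of 0]
  proof eventually_elim
    case (elim t)
    have shift: "c * mittag_leffler \<alpha> (\<gamma> + \<alpha>) (- c * t powr \<alpha>) * t powr (\<alpha> + \<beta> - 1) =
        (rGamma \<gamma> - mittag_leffler \<alpha> \<gamma> (- c * t powr \<alpha>)) * t powr (\<beta> - 1)" for c \<gamma>
    proof -
      have split: "t powr (\<alpha> + \<beta> - 1) = t powr \<alpha> * t powr (\<beta> - 1)"
        by (simp add: powr_add [symmetric] add_diff_eq)
      have "c * t powr \<alpha> * mittag_leffler \<alpha> (\<gamma> + \<alpha>) (- c * t powr \<alpha>) =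
          rGamma \<gamma> - mittag_leffler \<alpha> \<gamma> (- c * t powr \<alpha>)"
        using mittag_leffler_recurrence[OF \<alpha>(1), of "c * t powr \<alpha>" \<gamma>] by simp
      then show ?thesis
        unfolding split by (metis mult.assoc mult.commute)
    qed
    show ?case
    proof (cases "\<kappa> = \<mu>")
      case False
      then have "modal_response \<alpha> \<beta> \<kappa> \<mu> t =
        1 / (\<kappa> - \<mu>) * (\<kappa> * mittag_leffler \<alpha> (\<beta> + \<alpha>) (- \<kappa> * t powr \<alpha>) * t powr (\<alpha> + \<beta> - 1)
          - \<mu> * mittag_leffler \<alpha> (\<beta> + \<alpha>) (- \<mu> * t powr \<alpha>) * t powr (\<alpha> + \<beta> - 1))"
        using modal_response_nonresonant[OF \<alpha>(1) False, of \<beta> t]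
        by (simp add: algebra_simps diff_divide_distrib)
      also have "\<dots> = h t * t powr (\<beta> - 1)"
        unfolding shift using False by (simp add: h_def algebra_simps)
      finally show ?thesis .
    next
      case True
      have "rGamma (\<beta> - 1) = (\<beta> - 1) * rGamma \<beta>"
        using rGamma_plus1[of "\<beta> - 1"] by simp
      then have cancel: "rGamma (\<beta> - 1) + (1 - \<beta>) * rGamma \<beta> = 0"
        by (simp add: algebra_simps)
      have "modal_response \<alpha> \<beta> \<kappa> \<mu> t = 1 / (\<alpha> * \<mu>) *
          (\<mu> * mittag_leffler \<alpha> (\<beta> - 1 + \<alpha>) (- \<mu> * t powr \<alpha>) * t powr (\<alpha> + \<beta> - 1)
          + (1 - \<beta>) * (\<mu> * mittag_leffler \<alpha> (\<beta> + \<alpha>) (- \<mu> * t powr \<alpha>) * t powr (\<alpha> + \<beta> - 1)))"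
      proof -
        have "\<beta> - 1 + \<alpha> = \<alpha> + \<beta> - 1" "\<beta> + \<alpha> = \<alpha> + \<beta>" by simp_all
        moreover have "1 / \<alpha> * (a + (1 - \<beta>) * b) * p = 1 / (\<alpha> * \<mu>) * (\<mu> * a * p + (1 - \<beta>) * (\<mu> * b * p))"
          for a b p :: real
          using \<alpha> \<mu> by (simp add: field_simps)
        ultimately show ?thesis
          unfolding True modal_response_resonant[OF \<alpha>(1)] by (simp only:)
      qed
      also have "\<dots> = 1 / (\<alpha> * \<mu>) * ((rGamma (\<beta> - 1) + (1 - \<beta>) * rGamma \<beta>)
          - (mittag_leffler \<alpha> (\<beta> - 1) (- \<mu> * t powr \<alpha>)
            + (1 - \<beta>) * mittag_leffler \<alpha> \<beta> (- \<mu> * t powr \<alpha>))) * t powr (\<beta> - 1)"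
        unfolding shift by (simp add: algebra_simps)
      also have "\<dots> = h t * t powr (\<beta> - 1)"
      proof -
        have "1 / (\<alpha> * \<mu>) * (0 - a) * b = - 1 / (\<alpha> * \<mu>) * a * b" for a b :: real
          by simp
        then show ?thesis
          unfolding cancel h_def if_P[OF True] .
      qed
      finally show ?thesis .
    qed
  qed
  ultimately show ?thesis
    by (rule landau_o.big.in_cong[THEN iffD2, rotated])
qed

section \<open>Eigenspaces of the Sturm-Liouville problem\<close>

text \<open>The flux \<open>v = p * Y'\<close> turns the equation into a first-order system whose coefficients
  are continuous on the closed interval. It involves only \<open>Y'\<close>, so it is continuous up to
  the endpoints and has an initial value at 0.\<close>

lemma SL_eigenfunction_first_order_system:
  assumes Y: "SL_eigenfunction p q l \<mu> Y" and p: "C1_on {0..l} p"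
    and p_pos: "\<And>x. x \<in> {0..l} \<Longrightarrow> 0 < p x"
  obtains v where "continuous_on {0..l} Y" "continuous_on {0..l} v"
    "\<And>x. x \<in> {0<..<l} \<Longrightarrow> (Y has_real_derivative v x / p x) (at x)"
    "\<And>x. x \<in> {0<..<l} \<Longrightarrow> (v has_real_derivative (q x - \<mu>) * Y x) (at x)"
proof -
  obtain Y' where Y': "\<And>x. x \<in> {0..l} \<Longrightarrow> (Y has_real_derivative Y' x) (at x within {0..l})"
    and contY': "continuous_on {0..l} Y'"
    using Y unfolding SL_eigenfunction_def C1_on_def by blast
  obtain p' where p': "\<And>x. x \<in> {0..l} \<Longrightarrow> (p has_real_derivative p' x) (at x within {0..l})"
    using p unfolding C1_on_def by blast
  obtain Z where Z: "\<And>x. x \<in> {0<..<l} \<Longrightarrow> (Y has_real_derivative Z x) (at x within {0<..<l})"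
    and "C1_on {0<..<l} Z"
    using Y unfolding SL_eigenfunction_def C2_on_def by blast
  then obtain Z' where Z': "\<And>x. x \<in> {0<..<l} \<Longrightarrow> (Z has_real_derivative Z' x) (at x within {0<..<l})"
    unfolding C1_on_def by blast
  have contp: "continuous_on {0..l} p"
    using p' by (rule DERIV_continuous_on)
  have inside: "at x within {0..l} = at x" "at x within {0<..<l} = at x" if "x \<in> {0<..<l}" for x :: real
    using that by (auto intro!: at_within_interior at_within_open)
  have dY: "(Y has_real_derivative Y' x) (at x)" if "x \<in> {0<..<l}" for x
    using Y'[of x] inside[OF that] that by auto
  have dp: "(p has_real_derivative p' x) (at x)" if "x \<in> {0<..<l}" for x
    using p'[of x] inside[OF that] that by auto
  have Z_eq: "Z x = Y' x" "deriv Y x = Y' x" if "x \<in> {0<..<l}" for x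
    using DERIV_unique[OF Z[OF that, unfolded inside(2)[OF that]] dY[OF that]]
      DERIV_imp_deriv[OF dY[OF that]] by auto
  show ?thesis
  proof (rule that)
    show "continuous_on {0..l} Y"
      using Y' by (rule DERIV_continuous_on)
    show "continuous_on {0..l} (\<lambda>x. p x * Y' x)"
      by (intro continuous_on_mult contp contY')
    fix x assume x: "x \<in> {0<..<l}"
    show "(Y has_real_derivative p x * Y' x / p x) (at x)"
      using dY[OF x] p_pos[of x] x by simp
    have "((\<lambda>y. p y * Z y) has_real_derivative (p' x * Z x + Z' x * p x)) (at x)"
      using DERIV_mult[OF dp[OF x] Z'[OF x, unfolded inside(2)[OF x]]] .
    then have d1: "((\<lambda>y. p y * Y' y) has_real_derivative (p' x * Z x + Z' x * p x)) (at x)"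
      by (rule has_field_derivative_transform_within_open[of _ _ _ "{0<..<l}"]) (use x Z_eq in auto)
    then have "((\<lambda>y. p y * deriv Y y) has_real_derivative (p' x * Z x + Z' x * p x)) (at x)"
      by (rule has_field_derivative_transform_within_open[of _ _ _ "{0<..<l}"]) (use x Z_eq in auto)
    then have "deriv (\<lambda>y. p y * deriv Y y) x = p' x * Z x + Z' x * p x"
      by (rule DERIV_imp_deriv)
    moreover have "SL_op p q Y x = \<mu> * Y x"
      using Y x by (auto simp: SL_eigenfunction_def)
    ultimately have "p' x * Z x + Z' x * p x = (q x - \<mu>) * Y x"
      by (simp add: SL_op_def algebra_simps)
    with d1 show "((\<lambda>y. p y * Y' y) has_real_derivative (q x - \<mu>) * Y x) (at x)" by simp
  qed
qed

text \<open>Gronwall's argument for the energy \<open>Y\<^sup>2 + v\<^sup>2\<close>: its derivative is \<open>2 (r + q) Y v\<close>, so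
  the energy times \<open>exp (- M x)\<close> decreases if \<open>M\<close> bounds \<open>\<bar>r + q\<bar>\<close>.\<close>

lemma first_order_system_zero:
  fixes Y v r q :: "real \<Rightarrow> real"
  assumes contY: "continuous_on {0..l} Y" and contv: "continuous_on {0..l} v"
    and contr: "continuous_on {0..l} r" and contq: "continuous_on {0..l} q"
    and dY: "\<And>x. x \<in> {0<..<l} \<Longrightarrow> (Y has_real_derivative r x * v x) (at x)"
    and dv: "\<And>x. x \<in> {0<..<l} \<Longrightarrow> (v has_real_derivative q x * Y x) (at x)"
    and init: "Y 0 = 0" "v 0 = 0" and x: "x \<in> {0..l}"
  shows "Y x = 0"
proof -
  have "compact ((\<lambda>x. r x + q x) ` {0..l})"
    by (intro compact_continuous_image continuous_on_add contr contq) auto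
  then have "bounded ((\<lambda>x. r x + q x) ` {0..l})"
    by (rule compact_imp_bounded)
  then obtain M where "\<forall>y\<in>(\<lambda>x. r x + q x) ` {0..l}. norm y \<le> M"
    unfolding bounded_iff by blast
  then have M: "\<bar>r x + q x\<bar> \<le> M" if "x \<in> {0..l}" for x
    using that by auto
  define E where "E = (\<lambda>x. ((Y x)\<^sup>2 + (v x)\<^sup>2) * exp (- M * x))"
  have "E 0 \<ge> E x"
  proof (rule DERIV_nonpos_imp_decreasing_open[where f = E and a = 0 and b = x])
    show "0 \<le> x" using x by simp
    show "continuous_on {0..x} E"
      unfolding E_def using x
      by (intro continuous_intros continuous_on_subset[OF contY] continuous_on_subset[OF contv]) auto
    fix y assume y: "0 < y" "y < x"
    then have yl: "y \<in> {0<..<l}" using x by auto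
    let ?D = "(2 * (r y + q y) * (Y y * v y) - M * ((Y y)\<^sup>2 + (v y)\<^sup>2)) * exp (- M * y)"
    have "(E has_real_derivative ?D) (at y)"
      unfolding E_def
      by (auto intro!: derivative_eq_intros dY[OF yl] dv[OF yl] simp: algebra_simps power2_eq_square)
    moreover have "?D \<le> 0"
    proof -
      have "2 * \<bar>Y y * v y\<bar> \<le> (Y y)\<^sup>2 + (v y)\<^sup>2"
        using sum_squares_bound[of "\<bar>Y y\<bar>" "\<bar>v y\<bar>"] by (simp add: abs_mult)
      moreover have "\<bar>r y + q y\<bar> \<le> M" using M yl by auto
      ultimately have "\<bar>r y + q y\<bar> * (2 * \<bar>Y y * v y\<bar>) \<le> M * ((Y y)\<^sup>2 + (v y)\<^sup>2)"
        by (intro mult_mono) auto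
      moreover have "(r y + q y) * (Y y * v y) \<le> \<bar>r y + q y\<bar> * \<bar>Y y * v y\<bar>"
        by (simp flip: abs_mult)
      moreover have "\<bar>r y + q y\<bar> * (2 * \<bar>Y y * v y\<bar>) = 2 * (\<bar>r y + q y\<bar> * \<bar>Y y * v y\<bar>)"
        "2 * (r y + q y) * (Y y * v y) = 2 * ((r y + q y) * (Y y * v y))" by simp_all
      ultimately have "2 * (r y + q y) * (Y y * v y) - M * ((Y y)\<^sup>2 + (v y)\<^sup>2) \<le> 0"
        by linarith
      then show ?thesis by (intro mult_nonpos_nonneg) auto
    qed
    ultimately show "\<exists>z. (E has_real_derivative z) (at y) \<and> z \<le> 0" by blast
  qed
  then have "((Y x)\<^sup>2 + (v x)\<^sup>2) * exp (- M * x) \<le> 0" by (simp add: E_def init)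
  then have "(Y x)\<^sup>2 + (v x)\<^sup>2 \<le> 0"
    by (simp add: mult_le_0_iff)
  then show ?thesis by (simp add: sum_power2_le_zero_iff)
qed

text \<open>Both functions vanish at 0, so the combination of \<open>Y\<close> and \<open>Z\<close> whose flux vanishes at 0
  has zero initial data and is 0. The flux of \<open>Y\<close> itself at 0 is not 0, since \<open>Y\<close> is not
  the zero function.\<close>

proposition SL_eigenspace_one_dimensional:
  assumes Y: "SL_eigenfunction p q l \<mu> Y" and Z: "SL_eigenfunction p q l \<mu> Z"
    and p: "C1_on {0..l} p" and q: "continuous_on {0..l} q"
    and p_pos: "\<And>x. x \<in> {0..l} \<Longrightarrow> 0 < p x"
  obtains c where "\<And>x. x \<in> {0..l} \<Longrightarrow> Z x = c * Y x"
proof -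
  obtain v where v: "continuous_on {0..l} Y" "continuous_on {0..l} v"
    "\<And>x. x \<in> {0<..<l} \<Longrightarrow> (Y has_real_derivative v x / p x) (at x)"
    "\<And>x. x \<in> {0<..<l} \<Longrightarrow> (v has_real_derivative (q x - \<mu>) * Y x) (at x)"
    using SL_eigenfunction_first_order_system[OF Y p p_pos] by blast
  obtain w where w: "continuous_on {0..l} Z" "continuous_on {0..l} w"
    "\<And>x. x \<in> {0<..<l} \<Longrightarrow> (Z has_real_derivative w x / p x) (at x)"
    "\<And>x. x \<in> {0<..<l} \<Longrightarrow> (w has_real_derivative (q x - \<mu>) * Z x) (at x)"
    using SL_eigenfunction_first_order_system[OF Z p p_pos] by blast
  have cont_p: "continuous_on {0..l} p"
    using p by (auto simp: C1_on_def intro: DERIV_continuous_on)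
  have cont_inv: "continuous_on {0..l} (\<lambda>x. 1 / p x)"
    using p_pos by (intro continuous_intros cont_p) force
  have zero: "a * Y x + b * Z x = 0"
    if ab: "a * v 0 + b * w 0 = 0" and x: "x \<in> {0..l}" for a b x
  proof (rule first_order_system_zero[of l "\<lambda>x. a * Y x + b * Z x" "\<lambda>x. a * v x + b * w x"
      "\<lambda>x. 1 / p x" "\<lambda>x. q x - \<mu>"])
    show "continuous_on {0..l} (\<lambda>x. a * Y x + b * Z x)" "continuous_on {0..l} (\<lambda>x. a * v x + b * w x)"
      "continuous_on {0..l} (\<lambda>x. q x - \<mu>)"
      by (intro continuous_intros v w q)+
    show "a * Y 0 + b * Z 0 = 0" using Y Z by (simp add: SL_eigenfunction_def)
    fix x assume x: "x \<in> {0<..<l}"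
    show "((\<lambda>x. a * Y x + b * Z x) has_real_derivative 1 / p x * (a * v x + b * w x)) (at x)"
      using DERIV_add[OF DERIV_cmult[OF v(3)[OF x], of a] DERIV_cmult[OF w(3)[OF x], of b]]
      by (simp add: add_divide_distrib)
    show "((\<lambda>x. a * v x + b * w x) has_real_derivative (q x - \<mu>) * (a * Y x + b * Z x)) (at x)"
      using DERIV_add[OF DERIV_cmult[OF v(4)[OF x], of a] DERIV_cmult[OF w(4)[OF x], of b]]
      by (simp add: algebra_simps)
  qed (use ab x cont_inv in auto)
  have "v 0 \<noteq> 0"
  proof
    assume "v 0 = 0"
    then have "Y x = 0" if "x \<in> {0..l}" for x using zero[of 1 0 x] that by simp
    then show False using Y by (auto simp: SL_eigenfunction_def)
  qed
  show ?thesis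
  proof (rule that)
    fix x assume x: "x \<in> {0..l}"
    have "(- (w 0 / v 0)) * Y x + 1 * Z x = 0"
      by (rule zero) (use \<open>v 0 \<noteq> 0\<close> x in auto)
    then show "Z x = (w 0 / v 0) * Y x" by simp
  qed
qed

section \<open>Fourier solution for a source in one eigenspace\<close>

lemma continuous_imp_L2:
  assumes "continuous_on {0..l} f"
  shows "L2 l f"
  unfolding L2_def
proof
  have cont: "continuous_on {0<..<l} f"
    using assms by (rule continuous_on_subset) auto
  then show "f \<in> borel_measurable (lebesgue_on {0<..<l})"
    by (intro continuous_imp_measurable_on_sets_lebesgue) auto
  have "integrable (lebesgue_on {0..l}) (\<lambda>x. (f x)\<^sup>2)"
    using assms by (intro continuous_imp_integrable_real continuous_on_power)
  then have "set_integrable lebesgue {0..l} (\<lambda>x. (f x)\<^sup>2)"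
    by (simp add: integrable_restrict_space set_integrable_def)
  then have "set_integrable lebesgue {0<..<l} (\<lambda>x. (f x)\<^sup>2)"
    by (rule set_integrable_subset) auto
  then show "integrable (lebesgue_on {0<..<l}) (\<lambda>x. (f x)\<^sup>2)"
    by (intro absolutely_integrable_imp_integrable) auto
qed

lemma inner_L2_cmult_left: "inner_L2 l (\<lambda>x. c * f x) g = c * inner_L2 l f g"
  by (simp add: inner_L2_def mult.assoc)

lemma inner_L2_cong: "(\<And>x. x \<in> {0..l} \<Longrightarrow> f x = g x) \<Longrightarrow> inner_L2 l f h = inner_L2 l g h"
  unfolding inner_L2_def by (intro Bochner_Integration.integral_cong) auto

text \<open>By orthonormality the source has only one non-zero Fourier coefficient, and since \<open>Y\<close> is
  a multiple of \<open>X k\<close> everywhere on \<open>[0, l]\<close>, the series has the stated sum at every point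
  and not only in \<open>L\<^sup>2\<close>.\<close>

lemma fourier_solution_single_mode:
  assumes sys: "SL_eigensystem p q l \<Lambda> X" and Y: "\<And>x. x \<in> {0..l} \<Longrightarrow> Y x = c * X k x"
    and contY: "continuous_on {0..l} Y"
    and int: "\<And>i t. t \<ge> 0 \<Longrightarrow> integrable (lebesgue_on {0..t})
      (\<lambda>\<tau>. \<tau> powr (\<alpha> - 1) * mittag_leffler \<alpha> \<alpha> (- \<Lambda> i * \<tau> powr \<alpha>) * \<psi> (t - \<tau>))"
    and \<phi>: "\<And>t. t \<ge> 0 \<Longrightarrow> (LINT \<tau>|lebesgue_on {0..t}.
        \<tau> powr (\<alpha> - 1) * mittag_leffler \<alpha> \<alpha> (- \<Lambda> k * \<tau> powr \<alpha>) * \<psi> (t - \<tau>)) = \<phi> t"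
  shows "fourier_solution \<alpha> l \<Lambda> X (\<lambda>x. 0) (\<lambda>x t. \<psi> t * Y x) (\<lambda>x t. \<phi> t * Y x)"
proof -
  have inner_Y: "inner_L2 l Y (X i) = (if i = k then c else 0)" for i
  proof -
    have "inner_L2 l Y (X i) = inner_L2 l (\<lambda>x. c * X k x) (X i)"
      by (rule inner_L2_cong) (rule Y)
    also have "\<dots> = c * inner_L2 l (X k) (X i)"
      by (rule inner_L2_cmult_left)
    also have "\<dots> = (if i = k then c else 0)"
      using sys by (auto simp: SL_eigensystem_def complete_orthonormal_def)
    finally show ?thesis .
  qed
  have L2_data: "L2 l (\<lambda>x. 0)" "L2 l (\<lambda>x. d * Y x)" for d
    by (intro continuous_imp_L2 continuous_intros contY)+
  have int_i: "integrable (lebesgue_on {0..t})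
      (\<lambda>\<tau>. \<tau> powr (\<alpha> - 1) * mittag_leffler \<alpha> \<alpha> (- \<Lambda> i * \<tau> powr \<alpha>) * (\<psi> (t - \<tau>) * d))"
    if "t \<ge> 0" for i t d
    using integrable_mult_left[OF int[OF that, of i], of d] by (simp only: mult.assoc)
  have LINT_i: "(LINT \<tau>|lebesgue_on {0..t}.
      \<tau> powr (\<alpha> - 1) * mittag_leffler \<alpha> \<alpha> (- \<Lambda> i * \<tau> powr \<alpha>) * (\<psi> (t - \<tau>) * (if i = k then c else 0)))
      = (if i = k then \<phi> t * c else 0)" if "t \<ge> 0" for i t
    using \<phi>[OF that] by (simp flip: mult.assoc)
  show ?thesis
    unfolding fourier_solution_def inner_L2_cmult_left inner_Y
  proof (intro conjI allI impI ballI L2_data int_i)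
    fix x t :: real assume x: "x \<in> {0..l}" and t: "t \<ge> 0"
    have "(\<lambda>i. if i = k then \<phi> t * Y x else 0) sums (\<phi> t * Y x)"
      by (rule sums_single)
    moreover have "inner_L2 l (\<lambda>x. 0) g = 0" for g by (simp add: inner_L2_def)
    moreover have "(if i = k then \<phi> t * c else 0) * X i x = (if i = k then \<phi> t * Y x else 0)" for i
      by (simp add: Y[OF x])
    ultimately show "(\<lambda>i. (inner_L2 l (\<lambda>x. 0) (X i) * mittag_leffler \<alpha> 1 (- \<Lambda> i * t powr \<alpha>) +
        (LINT \<tau>|lebesgue_on {0..t}. \<tau> powr (\<alpha> - 1) * mittag_leffler \<alpha> \<alpha> (- \<Lambda> i * \<tau> powr \<alpha>) *
          (\<psi> (t - \<tau>) * (if i = k then c else 0)))) * X i x) sums (\<phi> t * Y x)"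
      unfolding LINT_i[OF t] by (simp only: mult_zero_left add_0)
  qed
qed

theorem theorem7:
  fixes \<alpha> \<beta> lam l :: real
    and p q Xk :: "real \<Rightarrow> real"
    and \<Lambda> :: "nat \<Rightarrow> real" and X :: "nat \<Rightarrow> real \<Rightarrow> real" and k :: nat
    and \<psi> :: "real \<Rightarrow> real"
  assumes "0 < \<alpha>" "\<alpha> \<le> 1" "0 < \<beta>" "0 < lam" "0 < l"
    and "C1_on {0..l} p" "continuous_on {0..l} q"
    and "\<And>x. x \<in> {0..l} \<Longrightarrow> 0 < p x" "\<And>x. x \<in> {0..l} \<Longrightarrow> 0 \<le> q x"
    and "SL_eigensystem p q l \<Lambda> X"
    and "SL_eigenfunction p q l (\<Lambda> k) Xk"
    and "\<And>t. \<psi> t = t powr (\<beta> - 1) * mittag_leffler \<alpha> \<beta> (- lam * t powr \<alpha>)"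
  shows "\<exists>\<phi>.
    fourier_solution \<alpha> l \<Lambda> X (\<lambda>x. 0) (\<lambda>x t. \<psi> t * Xk x) (\<lambda>x t. \<phi> t * Xk x) \<and>
    (lam \<noteq> \<Lambda> k \<longrightarrow>
       (\<forall>t>0. \<phi> t =
          (lam * mittag_leffler \<alpha> (\<alpha> + \<beta>) (- lam * t powr \<alpha>)
            - \<Lambda> k * mittag_leffler \<alpha> (\<alpha> + \<beta>) (- \<Lambda> k * t powr \<alpha>)) / (lam - \<Lambda> k)
          * t powr (\<alpha> + \<beta> - 1))) \<and>
    (lam = \<Lambda> k \<longrightarrow>
       (\<forall>t>0. \<phi> t =
          1 / \<alpha> * (mittag_leffler \<alpha> (\<alpha> + \<beta> - 1) (- \<Lambda> k * t powr \<alpha>)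
            + (1 - \<beta>) * mittag_leffler \<alpha> (\<alpha> + \<beta>) (- \<Lambda> k * t powr \<alpha>))
          * t powr (\<alpha> + \<beta> - 1))) \<and>
    (\<alpha> \<noteq> \<beta> \<longrightarrow> \<phi> \<in> O[at_top](\<lambda>t. t powr (\<beta> - \<alpha> - 1))) \<and>
    (\<alpha> = \<beta> \<longrightarrow> \<phi> \<in> O[at_top](\<lambda>t. t powr (- \<alpha> - 1)))"
proof -
  define \<phi> where "\<phi> = modal_response \<alpha> \<beta> lam (\<Lambda> k)"
  have \<Lambda>: "\<Lambda> i > 0" for i using assms(10) by (simp add: SL_eigensystem_def)
  have Xk': "SL_eigenfunction p q l (\<Lambda> k) (X k)"
    using assms(10) by (simp add: SL_eigensystem_def)
  obtain c where c: "\<And>x. x \<in> {0..l} \<Longrightarrow> Xk x = c * X k x"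
    using SL_eigenspace_one_dimensional[OF Xk' assms(11,6,7,8)] by blast
  have cont: "continuous_on {0..l} Xk"
    using assms(11) unfolding SL_eigenfunction_def C1_on_def by (blast intro: DERIV_continuous_on)
  have conv: "has_bochner_integral (lebesgue_on {0..t})
      (\<lambda>\<tau>. \<tau> powr (\<alpha> - 1) * mittag_leffler \<alpha> \<alpha> (- \<Lambda> i * \<tau> powr \<alpha>) * \<psi> (t - \<tau>))
      (modal_response \<alpha> \<beta> lam (\<Lambda> i) t)" if "t \<ge> 0" for i t
    using ml_kernel_convolution[OF assms(1) fps_conv_radius_geom fps_conv_radius_geom assms(1,3) that]
    unfolding assms(12) mittag_leffler_conv_transform modal_response_def ml_kernel_def[of \<alpha> \<alpha>] ml_kernel_def[of \<alpha> \<beta>] .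
  have "fourier_solution \<alpha> l \<Lambda> X (\<lambda>x. 0) (\<lambda>x t. \<psi> t * Xk x) (\<lambda>x t. \<phi> t * Xk x)"
    using conv unfolding has_bochner_integral_iff \<phi>_def
    by (intro fourier_solution_single_mode[OF assms(10) c cont]) auto
  moreover have "\<phi> \<in> O[at_top](\<lambda>t. t powr (\<beta> - \<alpha> - 1))"
  proof -
    have "\<phi> \<in> O[at_top](\<lambda>t. t powr (- \<alpha> + \<beta> - 1))"
      unfolding \<phi>_def by (intro modal_response_bigo mittag_leffler_bigo_powr assms \<Lambda>)
    then show ?thesis by (simp add: algebra_simps)
  qed
  moreover have "\<phi> \<in> O[at_top](\<lambda>t. t powr (- \<alpha> - 1))" if "\<alpha> = \<beta>"
  proof -
    have pole: "rGamma (\<beta> - \<alpha>) = 0" "rGamma (\<beta> - 1 - \<alpha>) = 0"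
      using that by (simp_all add: rGamma_eq_zero_iff)
    have "\<phi> \<in> O[at_top](\<lambda>t. t powr (- 2 * \<alpha> + \<beta> - 1))"
      unfolding \<phi>_def by (intro modal_response_bigo mittag_leffler_bigo_powr_pole pole assms \<Lambda>)
    then show ?thesis using that by (simp add: algebra_simps)
  qed
  ultimately show ?thesis
    using modal_response_nonresonant[OF assms(1)] modal_response_resonant[OF assms(1)]
    by (intro exI[of _ \<phi>]) (simp add: \<phi>_def)
qed

end
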